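(* Let $\alpha,\delta\in\mathbb R$ with $\delta\neq 0$, let $(L(t))_{t\in\mathbb R}$ be a two-sided Lévy process and let $(Y_t)_{t\in\mathbb R}:=\big(L(\tfrac{e^{\delta t}-1}{e^\delta-1})\big)_{t\in\mathbb R}$ be the time-changed Lévy process. Then each of the following conditions is sufficient for the almost sure convergence of $$\int_a^be^{t(\alpha-\delta/2)}\,dY_t\quad\text{as }a\downarrow-\infty\text{ for any }b\in\mathbb R.$$ (a) $\delta>0$ and $\alpha>\delta/2$. (b) $\delta<0$, $\alpha>-\delta/2$ and $$\sup_{\frac1\delta\log2\le s\le0}\mathbb E\left[\Big|\int_s^0e^{t(\alpha-\delta/2)}\,dY_t\Big|^{\gamma}\right]<\infty\quad\text{for some }\gamma>\frac{-\delta}{\alpha+\delta/2}.$$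
   Context: All processes are real-valued. Two-sided Lévy process generated by the law of an infinitely divisible random variable: $L(t)=L^{(1)}(t)$ for $t\ge0$ and $L(t)=-L^{(2)}((-t)-)$ for $t<0$ (left limit at $-t$), where $L^{(1)},L^{(2)}$ are independent copies of the (càdlàg) Lévy process whose value at time $1$ has that law. Random integral: for a process $Y$ with càdlàg paths, a continuously differentiable function $A$ and $a<b$, $\int_a^bA(t)\,dY_t:=A(b)Y_b-A(a)Y_a-\int_a^bA'(t)Y_t\,dt$ (pathwise Riemann integral). *)

theory Defs
  imports "HOL-Probability.Probability"
begin

definition cadlag_on_nonneg :: "(real \<Rightarrow> real) \<Rightarrow> bool" where
  "cadlag_on_nonneg f \<longleftrightarrow>
     (\<forall>t\<ge>0. (f \<longlongrightarrow> f t) (at_right t)) \<and>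
     (\<forall>t>0. \<exists>l. (f \<longlongrightarrow> l) (at_left t))"

text \<open>Only the values of \<open>X\<close> at nonnegative times are constrained. Stochastic continuity
  is not listed: it follows from stationarity of the increments and right-continuity at 0.\<close>

locale levy_process = prob_space M for M :: "'a measure" +
  fixes X :: "real \<Rightarrow> 'a \<Rightarrow> real"
  assumes rv: "t \<ge> 0 \<Longrightarrow> random_variable borel (X t)"
    and start_0: "AE \<omega> in M. X 0 \<omega> = 0"
    and indep_increments:
      "\<And>(n::nat) (t::nat \<Rightarrow> real). 0 \<le> t 0 \<Longrightarrow> (\<And>i. i < n \<Longrightarrow> t i < t (Suc i)) \<Longrightarrow>
         indep_vars (\<lambda>_. borel) (\<lambda>i \<omega>. X (t (Suc i)) \<omega> - X (t i) \<omega>) {..<n}"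
    and stationary_increments:
      "s \<ge> 0 \<Longrightarrow> t \<ge> 0 \<Longrightarrow>
         distr M borel (\<lambda>\<omega>. X (s + t) \<omega> - X s \<omega>) = distr M borel (X t)"
    and cadlag_paths: "AE \<omega> in M. cadlag_on_nonneg (\<lambda>t. X t \<omega>)"

definition infinitely_divisible :: "real measure \<Rightarrow> bool" where
  "infinitely_divisible \<mu> \<longleftrightarrow>
     (\<forall>n\<ge>1. \<exists>\<nu>::real measure. prob_space \<nu> \<and> sets \<nu> = sets borel \<and>
        \<mu> = distr (PiM {..<n::nat} (\<lambda>_. \<nu>)) borel (\<lambda>x. \<Sum>i<n. x i))"

text \<open>\<open>L1\<close> and \<open>L2\<close> are independent as processes, that is, as random elements of the
  product space of paths on \<open>{0..}\<close>. They are copies of each other because the law at time 1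
  determines the law of a Levy process. The left limit exists for almost every \<open>\<omega>\<close>; for the
  others \<open>Lim\<close> is unspecified.\<close>

definition two_sided_levy_process ::
    "'a measure \<Rightarrow> real measure \<Rightarrow> (real \<Rightarrow> 'a \<Rightarrow> real) \<Rightarrow> bool" where
  "two_sided_levy_process M \<mu> L \<longleftrightarrow>
     (\<exists>L1 L2. levy_process M L1 \<and> levy_process M L2 \<and>
        distr M borel (L1 1) = \<mu> \<and> distr M borel (L2 1) = \<mu> \<and>
        prob_space.indep_var M
          (PiM {0..} (\<lambda>_. borel)) (\<lambda>\<omega>. \<lambda>t\<in>{0..}. L1 t \<omega>)
          (PiM {0..} (\<lambda>_. borel)) (\<lambda>\<omega>. \<lambda>t\<in>{0..}. L2 t \<omega>) \<and>
        (\<forall>t. \<forall>\<omega>\<in>space M. L t \<omega> =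
           (if t \<ge> 0 then L1 t \<omega> else - Lim (at_left (- t)) (\<lambda>s. L2 s \<omega>))))"

text \<open>The integral of a deterministic continuously differentiable \<open>A\<close> against a cadlag
  process \<open>Y\<close> over \<open>[a, b]\<close>, by partial integration. The pathwise Riemann integral is written
  with the Henstock-Kurzweil integral, which agrees with it on cadlag paths.\<close>

definition random_integral ::
    "(real \<Rightarrow> real) \<Rightarrow> (real \<Rightarrow> 'a \<Rightarrow> real) \<Rightarrow> real \<Rightarrow> real \<Rightarrow> 'a \<Rightarrow> real" where
  "random_integral A Y a b \<omega> =
     A b * Y b \<omega> - A a * Y a \<omega> - integral {a..b} (\<lambda>t. deriv A t * Y t \<omega>)"

end

theory Submission
  imports Defs
begin

text \<open>
  Put \<open>\<beta> = \<alpha> - \<delta> / 2 > 0\<close>. By partial integration, the integral converges as soon as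
  \<open>Y t = O(exp (- \<theta> t))\<close> at \<open>-\<infinity>\<close> for some \<open>\<theta> < \<beta>\<close>. In case (a) the time change is bounded
  below, so \<open>Y\<close> is bounded at \<open>-\<infinity>\<close>. In case (b) it suffices that the Levy process \<open>X\<close> on the
  negative half-line is almost surely \<open>O(u powr (1 + q))\<close> for some \<open>q < (\<beta> + \<delta>) / (- \<delta>)\<close>. The
  random integrals over \<open>[s, 0]\<close> are limits of sums of independent variables, so Etemadi's
  inequality turns the moment bound into a tail bound of order \<open>x powr (- \<gamma>)\<close> for their supremum
  over \<open>s\<close>. A maximum principle recovers \<open>X\<close> from these integrals and gives the same tail for
  \<open>X u\<close> with \<open>u\<close> small. By stationarity and Etemadi's inequality again, the oscillations of \<open>X\<close>
  over the blocks \<open>[n T, (n + 1) T]\<close> have this tail, and since one can choose \<open>q > 1 / \<gamma>\<close>, the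
  Borel-Cantelli lemma bounds them eventually by a multiple of \<open>n powr q\<close>. Summing over blocks
  yields the growth bound.
\<close>

section \<open>Maximal inequalities\<close>

text \<open>Split according to the first index \<open>k\<close> in \<open>F\<close> whose partial
  sum exceeds \<open>3 * x\<close> in absolute value: either the full sum exceeds \<open>x\<close>,
  or the remaining sum exceeds \<open>2 * x\<close>. The remaining sum is independent of the past up
  to \<open>k\<close> and is that large with probability at most \<open>2 * p\<close>. Taking the
  maximum over \<open>F\<close> only means that tail bounds are asked for at these indices
  only.\<close>

lemma (in prob_space) etemadi_maximal_inequality:
  fixes X :: "nat \<Rightarrow> 'a \<Rightarrow> real"
  assumes ind: "indep_vars (\<lambda>_. borel) X {..<n}"
    and F: "F \<subseteq> {..n}" "n \<in> F"
    and p: "\<And>k. k \<in> F \<Longrightarrow> prob {\<omega>\<in>space M. \<bar>\<Sum>i<k. X i \<omega>\<bar> > x} \<le> p"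
  shows "prob {\<omega>\<in>space M. \<exists>k\<in>F. \<bar>\<Sum>i<k. X i \<omega>\<bar> > 3 * x} \<le> 3 * p"
proof -
  define S where "S k \<omega> = (\<Sum>i<k. X i \<omega>)" for k \<omega>
  define T where "T k = {\<omega>\<in>space M. \<bar>S k \<omega>\<bar> > 3 * x \<and> (\<forall>j\<in>F. j < k \<longrightarrow> \<bar>S j \<omega>\<bar> \<le> 3 * x)}" for k
  define D where "D k = {\<omega>\<in>space M. \<bar>S n \<omega> - S k \<omega>\<bar> > 2 * x}" for k
  have finF: "finite F" using F(1) finite_subset by blast
  have X[measurable]: "X i \<in> borel_measurable M" if "i < n" for i
    using ind that unfolding indep_vars_def by auto
  have S[measurable]: "S k \<in> borel_measurable M" if "k \<in> F" for k
    unfolding S_def using that F(1) by (intro borel_measurable_sum X) auto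
  have Tm: "T k \<in> events" if "k \<in> F" for k
  proof -
    have [measurable]: "S k \<in> borel_measurable M" by (rule S[OF that])
    have "T k = {\<omega>\<in>space M. \<bar>S k \<omega>\<bar> > 3 * x} \<inter> {\<omega>\<in>space M. \<forall>j\<in>F. j < k \<longrightarrow> \<bar>S j \<omega>\<bar> \<le> 3 * x}"
      unfolding T_def by auto
    also have "\<dots> \<in> events"
      using finF S by (intro sets.Int sets.sets_Collect_finite_All sets.sets_Collect_imp) auto
    finally show ?thesis .
  qed
  have Dm: "D k \<in> events" if "k \<in> F" for k
    unfolding D_def using S[OF that] S[OF F(2)] by measurable
  \<comment> \<open>\<open>T k\<close> is decided by the variables with index below
    \<open>k\<close>, and \<open>D k\<close> by those from \<open>k\<close> to
    \<open>n - 1\<close>.\<close>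
  have indep: "prob (T k \<inter> D k) = prob (T k) * prob (D k)" if k: "k \<in> F" for k
  proof -
    have kn: "k \<le> n" using k F(1) by auto
    let ?A = "\<lambda>\<omega>. restrict (\<lambda>i. X i \<omega>) {..<k}" and ?B = "\<lambda>\<omega>. restrict (\<lambda>i. X i \<omega>) {k..<n}"
    have iv: "indep_var (PiM {..<k} (\<lambda>_. borel)) ?A (PiM {k..<n} (\<lambda>_. borel)) ?B"
      using kn by (intro indep_var_restrict[OF ind]) auto
    define A where "A = {v \<in> space (PiM {..<k} (\<lambda>_. borel::real measure)). \<bar>\<Sum>i<k. v i\<bar> > 3 * x \<and>
        (\<forall>j\<in>F. j < k \<longrightarrow> \<bar>\<Sum>i<j. v i\<bar> \<le> 3 * x)}"
    define B where "B = {v \<in> space (PiM {k..<n} (\<lambda>_. borel::real measure)). \<bar>\<Sum>i\<in>{k..<n}. v i\<bar> > 2 * x}"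
    have ms: "(\<lambda>v. \<Sum>i<j. v i) \<in> borel_measurable (PiM {..<k} (\<lambda>_. borel::real measure))" if "j \<le> k" for j
      using that by (intro borel_measurable_sum measurable_component_singleton) auto
    have "A = {v \<in> space (PiM {..<k} (\<lambda>_. borel::real measure)). \<bar>\<Sum>i<k. v i\<bar> > 3 * x} \<inter>
       {v \<in> space (PiM {..<k} (\<lambda>_. borel::real measure)). \<forall>j\<in>{j\<in>F. j < k}. \<bar>\<Sum>i<j. v i\<bar> \<le> 3 * x}"
      unfolding A_def by auto
    also have "\<dots> \<in> sets (PiM {..<k} (\<lambda>_. borel))"
      using finF ms[OF order_refl] ms by (intro sets.Int sets.sets_Collect_finite_All) auto
    finally have Am: "A \<in> sets (PiM {..<k} (\<lambda>_. borel))" .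
    have "(\<lambda>v. \<Sum>i\<in>{k..<n}. v i) \<in> borel_measurable (PiM {k..<n} (\<lambda>_. borel::real measure))"
      by (intro borel_measurable_sum measurable_component_singleton) auto
    then have Bm: "B \<in> sets (PiM {k..<n} (\<lambda>_. borel))" unfolding B_def by measurable
    have ASp: "?A \<omega> \<in> space (PiM {..<k} (\<lambda>_. borel))" "?B \<omega> \<in> space (PiM {k..<n} (\<lambda>_. borel))" for \<omega>
      by (auto simp: space_PiM)
    have sA: "(\<Sum>i<j. ?A \<omega> i) = S j \<omega>" if "j \<le> k" for j \<omega>
      unfolding S_def using that by (intro sum.cong) auto
    have sB: "(\<Sum>i\<in>{k..<n}. ?B \<omega> i) = S n \<omega> - S k \<omega>" for \<omega>
      unfolding S_def lessThan_atLeast0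
      using sum_diff_nat_ivl[of 0 k n "\<lambda>i. X i \<omega>"] kn by simp
    have TA: "?A -` A \<inter> space M = T k"
      unfolding A_def T_def using ASp sA by (auto simp del: restrict_apply)
    have DB: "?B -` B \<inter> space M = D k"
      unfolding B_def D_def using ASp sB by (auto simp del: restrict_apply)
    have "prob ((\<lambda>\<omega>. (?A \<omega>, ?B \<omega>)) -` (A \<times> B) \<inter> space M) = prob (T k) * prob (D k)"
      using indep_varD[OF iv Am Bm] TA DB by simp
    moreover have "(\<lambda>\<omega>. (?A \<omega>, ?B \<omega>)) -` (A \<times> B) \<inter> space M = T k \<inter> D k"
      using TA DB by auto
    ultimately show ?thesis by simp
  qed
  have pS: "prob {\<omega>\<in>space M. \<bar>S k \<omega>\<bar> > x} \<le> p" if "k \<in> F" for k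
    using p[OF that] by (simp add: S_def)
  have Dp: "prob (D k) \<le> 2 * p" if k: "k \<in> F" for k
  proof -
    have [measurable]: "S k \<in> borel_measurable M" "S n \<in> borel_measurable M" by (rule S[OF k], rule S[OF F(2)])
    have "prob (D k) \<le> prob ({\<omega>\<in>space M. \<bar>S n \<omega>\<bar> > x} \<union> {\<omega>\<in>space M. \<bar>S k \<omega>\<bar> > x})"
      unfolding D_def by (rule finite_measure_mono) auto
    also have "\<dots> \<le> prob {\<omega>\<in>space M. \<bar>S n \<omega>\<bar> > x} + prob {\<omega>\<in>space M. \<bar>S k \<omega>\<bar> > x}"
      by (rule measure_Un_le) auto
    also have "\<dots> \<le> 2 * p" using pS[OF k] pS[OF F(2)] by simp
    finally show ?thesis .
  qed
  have disj: "disjoint_family_on T F"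
    unfolding disjoint_family_on_def
  proof (intro ballI impI)
    fix j k assume "j \<in> F" "k \<in> F" "j \<noteq> k"
    then show "T j \<inter> T k = {}" by (cases j k rule: linorder_cases) (force simp: T_def)+
  qed
  \<comment> \<open>Disjointness of the first exceedance events keeps the final bound free of the
    size of \<open>F\<close>.\<close>
  have sumT: "(\<Sum>k\<in>F. prob (T k)) \<le> 1"
    using finite_measure_finite_Union[OF finF _ disj] Tm prob_le_1[of "\<Union>k\<in>F. T k"]
    by (simp add: image_subset_iff)
  have p0: "0 \<le> p" using pS[OF F(2)] measure_nonneg order_trans by blast
  have sub: "{\<omega>\<in>space M. \<exists>k\<in>F. \<bar>S k \<omega>\<bar> > 3 * x} \<subseteq> {\<omega>\<in>space M. \<bar>S n \<omega>\<bar> > x} \<union> (\<Union>k\<in>F. T k \<inter> D k)"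
  proof
    fix \<omega> assume "\<omega> \<in> {\<omega>\<in>space M. \<exists>k\<in>F. \<bar>S k \<omega>\<bar> > 3 * x}"
    then obtain k0 where sp: "\<omega> \<in> space M" and k0: "k0 \<in> F \<and> \<bar>S k0 \<omega>\<bar> > 3 * x" by auto
    define k where "k = (LEAST k. k \<in> F \<and> \<bar>S k \<omega>\<bar> > 3 * x)"
    have k: "k \<in> F \<and> \<bar>S k \<omega>\<bar> > 3 * x" unfolding k_def by (rule LeastI[of _ k0]) (rule k0)
    have "\<not> (j \<in> F \<and> \<bar>S j \<omega>\<bar> > 3 * x)" if "j < k" for j
      using not_less_Least that unfolding k_def by blast
    then have "\<omega> \<in> T k" unfolding T_def using k sp by (auto simp: not_less)
    moreover have "\<omega> \<in> D k" if "\<bar>S n \<omega>\<bar> \<le> x" unfolding D_def using that k sp by auto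
    ultimately show "\<omega> \<in> {\<omega>\<in>space M. \<bar>S n \<omega>\<bar> > x} \<union> (\<Union>k\<in>F. T k \<inter> D k)"
      using k sp by (auto simp: not_less)
  qed
  have [measurable]: "S n \<in> borel_measurable M" by (rule S[OF F(2)])
  have TD: "T k \<inter> D k \<in> events" if "k \<in> F" for k using Tm[OF that] Dm[OF that] by auto
  have U: "(\<Union>k\<in>F. T k \<inter> D k) \<in> events" using TD finF by auto
  have "prob {\<omega>\<in>space M. \<exists>k\<in>F. \<bar>S k \<omega>\<bar> > 3 * x} \<le> prob ({\<omega>\<in>space M. \<bar>S n \<omega>\<bar> > x} \<union> (\<Union>k\<in>F. T k \<inter> D k))"
    using U by (intro finite_measure_mono sub) auto
  also have "\<dots> \<le> prob {\<omega>\<in>space M. \<bar>S n \<omega>\<bar> > x} + prob (\<Union>k\<in>F. T k \<inter> D k)"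
    using U by (intro measure_Un_le) auto
  also have "prob (\<Union>k\<in>F. T k \<inter> D k) \<le> (\<Sum>k\<in>F. prob (T k \<inter> D k))"
    using TD by (intro measure_UNION_le finF) auto
  also have "\<dots> \<le> (\<Sum>k\<in>F. prob (T k) * (2 * p))"
    using indep Dp by (intro sum_mono) (simp add: mult_left_mono)
  also have "\<dots> \<le> 1 * (2 * p)"
    using sumT p0 unfolding sum_distrib_right[symmetric] by (intro mult_right_mono) auto
  finally show ?thesis using pS[OF F(2)] unfolding S_def by simp
qed

text \<open>Fatou's lemma for events: the tail intersections \<open>B n\<close> increase to the
  lower limit of the sets \<open>A n\<close>, which contains \<open>E\<close> up to a null
  set.\<close>

lemma (in prob_space) eventually_prob_le:
  assumes E: "E \<in> events" and A: "\<And>n. A n \<in> events" and e: "e > 0"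
    and AE: "AE \<omega> in M. \<omega> \<in> E \<longrightarrow> eventually (\<lambda>n. \<omega> \<in> A n) sequentially"
  shows "eventually (\<lambda>n. prob E \<le> prob (A n) + e) sequentially"
proof -
  define B where "B n = (\<Inter>m\<in>{n..}. A m)" for n
  have B: "B n \<in> events" for n unfolding B_def using A by auto
  have "incseq B" unfolding B_def incseq_def by fastforce
  then have "(\<lambda>n. prob (B n)) \<longlonglongrightarrow> prob (\<Union>n. B n)"
    using B by (intro finite_Lim_measure_incseq) auto
  moreover have "prob E \<le> prob (\<Union>n. B n)"
  proof (rule finite_measure_mono_AE)
    show "AE \<omega> in M. \<omega> \<in> E \<longrightarrow> \<omega> \<in> (\<Union>n. B n)"
      using AE by eventually_elim (auto simp: B_def eventually_sequentially)
  qed (use B in auto)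
  ultimately have "eventually (\<lambda>n. prob E - e < prob (B n)) sequentially"
    using e by (intro order_tendstoD(1)) auto
  then show ?thesis
  proof eventually_elim
    case (elim n)
    have "prob (B n) \<le> prob (A n)" using A by (intro finite_measure_mono) (auto simp: B_def)
    then show ?case using elim by simp
  qed
qed

text \<open>The tail bound is known for the limits \<open>J c\<close> only, and the convergence is not uniform over the
  refining sums. Hence the maximum runs over a fixed finite set \<open>C\<close> of coarse points.\<close>

lemma (in prob_space) etemadi_maximal_inequality_limit:
  fixes X :: "nat \<Rightarrow> nat \<Rightarrow> 'a \<Rightarrow> real" and J :: "nat \<Rightarrow> 'a \<Rightarrow> real"
  assumes ind: "\<And>m. indep_vars (\<lambda>_. borel) (X m) {..<k m n}"
    and C: "finite C" "n \<in> C" "\<And>m c. c \<in> C \<Longrightarrow> k m c \<le> k m n"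
    and J[measurable]: "\<And>c. c \<in> C \<Longrightarrow> random_variable borel (J c)"
    and lim: "\<And>c. c \<in> C \<Longrightarrow> AE \<omega> in M. (\<lambda>m. \<Sum>i<k m c. X m i \<omega>) \<longlonglongrightarrow> J c \<omega>"
    and p: "\<And>c. c \<in> C \<Longrightarrow> prob {\<omega>\<in>space M. \<bar>J c \<omega>\<bar> \<ge> x} \<le> p"
  shows "prob {\<omega>\<in>space M. \<exists>c\<in>C. \<bar>J c \<omega>\<bar> > 3 * x} \<le> 3 * p"
proof (rule field_le_epsilon)
  fix e :: real assume e: "e > 0"
  define S where "S m c \<omega> = (\<Sum>i<k m c. X m i \<omega>)" for m c \<omega>
  have Xm: "X m i \<in> borel_measurable M" if "i < k m n" for m i
    using ind[of m] that unfolding indep_vars_def by auto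
  have S[measurable]: "S m c \<in> borel_measurable M" if "c \<in> C" for m c
    unfolding S_def using C(3)[OF that, of m] by (intro borel_measurable_sum Xm) auto
  have AE_lim: "AE \<omega> in M. \<forall>c\<in>C. (\<lambda>m. S m c \<omega>) \<longlonglongrightarrow> J c \<omega>"
    unfolding S_def using lim C(1) by (intro AE_finite_allI) auto
  \<comment> \<open>A strict inequality for the limit \<open>J c\<close> passes to the sums. The
    tail bound for the sums then follows by complements, which is why the hypothesis on
    \<open>J c\<close> concerns the closed event with \<open>\<ge> x\<close>.\<close>
  have small: "eventually (\<lambda>m. prob {\<omega>\<in>space M. \<bar>J c \<omega>\<bar> < x} \<le> prob {\<omega>\<in>space M. \<bar>S m c \<omega>\<bar> \<le> x} + e / 4) sequentially"
    if c: "c \<in> C" for c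
  proof (rule eventually_prob_le)
    have [measurable]: "J c \<in> borel_measurable M" "S m c \<in> borel_measurable M" for m
      using J[OF c] S[OF c] by auto
    show "{\<omega>\<in>space M. \<bar>J c \<omega>\<bar> < x} \<in> events" "{\<omega>\<in>space M. \<bar>S m c \<omega>\<bar> \<le> x} \<in> events" for m
      by measurable
    show "AE \<omega> in M. \<omega> \<in> {\<omega>\<in>space M. \<bar>J c \<omega>\<bar> < x} \<longrightarrow>
        eventually (\<lambda>m. \<omega> \<in> {\<omega>\<in>space M. \<bar>S m c \<omega>\<bar> \<le> x}) sequentially"
      using AE_lim
    proof eventually_elim
      case (elim \<omega>)
      have l: "(\<lambda>m. \<bar>S m c \<omega>\<bar>) \<longlonglongrightarrow> \<bar>J c \<omega>\<bar>" using elim c by (intro tendsto_rabs) auto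
      show ?case
      proof
        assume "\<omega> \<in> {\<omega>\<in>space M. \<bar>J c \<omega>\<bar> < x}"
        then have \<omega>: "\<omega> \<in> space M" "\<bar>J c \<omega>\<bar> < x" by auto
        have "eventually (\<lambda>m. \<bar>S m c \<omega>\<bar> < x) sequentially" using l \<omega>(2) by (rule order_tendstoD)
        then show "eventually (\<lambda>m. \<omega> \<in> {\<omega>\<in>space M. \<bar>S m c \<omega>\<bar> \<le> x}) sequentially"
          by eventually_elim (use \<omega> in auto)
      qed
    qed
  qed (use e in simp)
  have large: "eventually (\<lambda>m. prob {\<omega>\<in>space M. \<exists>c\<in>C. \<bar>J c \<omega>\<bar> > 3 * x} \<le>
      prob {\<omega>\<in>space M. \<exists>c\<in>C. \<bar>S m c \<omega>\<bar> > 3 * x} + e / 4) sequentially"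
  proof (rule eventually_prob_le)
    show "{\<omega>\<in>space M. \<exists>c\<in>C. \<bar>J c \<omega>\<bar> > 3 * x} \<in> events"
      "{\<omega>\<in>space M. \<exists>c\<in>C. \<bar>S m c \<omega>\<bar> > 3 * x} \<in> events" for m
      using J S C(1) by (intro sets.sets_Collect_finite_Ex; simp)+
    show "AE \<omega> in M. \<omega> \<in> {\<omega>\<in>space M. \<exists>c\<in>C. \<bar>J c \<omega>\<bar> > 3 * x} \<longrightarrow>
        eventually (\<lambda>m. \<omega> \<in> {\<omega>\<in>space M. \<exists>c\<in>C. \<bar>S m c \<omega>\<bar> > 3 * x}) sequentially"
      using AE_lim
    proof eventually_elim
      case (elim \<omega>)
      show ?case
      proof
        assume "\<omega> \<in> {\<omega>\<in>space M. \<exists>c\<in>C. \<bar>J c \<omega>\<bar> > 3 * x}"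
        then obtain c where c: "c \<in> C" "3 * x < \<bar>J c \<omega>\<bar>" "\<omega> \<in> space M" by blast
        have "(\<lambda>m. \<bar>S m c \<omega>\<bar>) \<longlonglongrightarrow> \<bar>J c \<omega>\<bar>" using elim c by (intro tendsto_rabs) auto
        then have "eventually (\<lambda>m. 3 * x < \<bar>S m c \<omega>\<bar>) sequentially" using c(2) by (rule order_tendstoD)
        then show "eventually (\<lambda>m. \<omega> \<in> {\<omega>\<in>space M. \<exists>c\<in>C. \<bar>S m c \<omega>\<bar> > 3 * x}) sequentially"
          by eventually_elim (use c in auto)
      qed
    qed
  qed (use e in simp)
  have "eventually (\<lambda>m. \<forall>c\<in>C. prob {\<omega>\<in>space M. \<bar>J c \<omega>\<bar> < x} \<le> prob {\<omega>\<in>space M. \<bar>S m c \<omega>\<bar> \<le> x} + e / 4) sequentially"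
    using small C(1) by (intro eventually_ball_finite) auto
  from eventually_conj[OF large this] obtain m where
    m: "prob {\<omega>\<in>space M. \<exists>c\<in>C. \<bar>J c \<omega>\<bar> > 3 * x} \<le> prob {\<omega>\<in>space M. \<exists>c\<in>C. \<bar>S m c \<omega>\<bar> > 3 * x} + e / 4"
    "\<And>c. c \<in> C \<Longrightarrow> prob {\<omega>\<in>space M. \<bar>J c \<omega>\<bar> < x} \<le> prob {\<omega>\<in>space M. \<bar>S m c \<omega>\<bar> \<le> x} + e / 4"
    unfolding eventually_sequentially by blast
  \<comment> \<open>Etemadi's inequality triples this slack \<open>e / 4\<close>; together with the
    \<open>e / 4\<close> of \<open>large\<close> it adds up to \<open>e\<close>.\<close>
  have pS: "prob {\<omega>\<in>space M. \<bar>S m c \<omega>\<bar> > x} \<le> p + e / 4" if c: "c \<in> C" for c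
  proof -
    have [measurable]: "J c \<in> borel_measurable M" "S m c \<in> borel_measurable M"
      using J[OF c] S[OF c] by auto
    have "prob {\<omega>\<in>space M. \<not> \<bar>S m c \<omega>\<bar> \<le> x} = 1 - prob {\<omega>\<in>space M. \<bar>S m c \<omega>\<bar> \<le> x}"
      by (rule prob_neg) measurable
    moreover have "prob {\<omega>\<in>space M. \<not> \<bar>J c \<omega>\<bar> < x} = 1 - prob {\<omega>\<in>space M. \<bar>J c \<omega>\<bar> < x}"
      by (rule prob_neg) measurable
    ultimately show ?thesis using m(2)[OF c] p[OF c] by (simp add: not_le not_less)
  qed
  have "prob {\<omega>\<in>space M. \<exists>j\<in>k m ` C. \<bar>\<Sum>i<j. X m i \<omega>\<bar> > 3 * x} \<le> 3 * (p + e / 4)"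
    by (rule etemadi_maximal_inequality[OF ind]) (use C pS in \<open>auto simp: S_def\<close>)
  then have "prob {\<omega>\<in>space M. \<exists>c\<in>C. \<bar>S m c \<omega>\<bar> > 3 * x} \<le> 3 * (p + e / 4)"
    by (simp add: S_def)
  then show "prob {\<omega>\<in>space M. \<exists>c\<in>C. \<bar>J c \<omega>\<bar> > 3 * x} \<le> 3 * p + e"
    using m(1) by simp
qed

text \<open>Markov's inequality for the power \<open>\<gamma>\<close> of
  \<open>\<bar>f \<omega>\<bar>\<close>.\<close>

lemma (in prob_space) prob_ge_le_moment:
  assumes [measurable]: "random_variable borel f"
    and le: "(\<integral>\<^sup>+\<omega>. ennreal (\<bar>f \<omega>\<bar> powr \<gamma>) \<partial>M) \<le> ennreal C"
    and x: "x > 0" and \<gamma>: "\<gamma> > 0" and C: "C \<ge> 0"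
  shows "prob {\<omega>\<in>space M. \<bar>f \<omega>\<bar> \<ge> x} \<le> C * x powr (- \<gamma>)"
proof -
  have "emeasure M {\<omega>\<in>space M. \<bar>f \<omega>\<bar> \<ge> x} \<le>
     emeasure M ({\<omega>\<in>space M. 1 \<le> ennreal (x powr (- \<gamma>)) * ennreal (\<bar>f \<omega>\<bar> powr \<gamma>)} \<inter> space M)"
  proof (rule emeasure_mono)
    have "1 \<le> x powr (- \<gamma>) * y powr \<gamma>" if "y \<ge> x" for y
    proof -
      have "x powr \<gamma> \<le> y powr \<gamma>" using that x \<gamma> by (intro powr_mono2) auto
      then show ?thesis using x by (simp add: powr_minus field_simps)
    qed
    then show "{\<omega>\<in>space M. \<bar>f \<omega>\<bar> \<ge> x} \<subseteq> {\<omega>\<in>space M. 1 \<le> ennreal (x powr (- \<gamma>)) * ennreal (\<bar>f \<omega>\<bar> powr \<gamma>)} \<inter> space M"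
      by (auto simp flip: ennreal_mult ennreal_1 intro!: ennreal_leI)
  qed measurable
  also have "\<dots> \<le> ennreal (x powr (- \<gamma>)) * (\<integral>\<^sup>+\<omega>. ennreal (\<bar>f \<omega>\<bar> powr \<gamma>) * indicator (space M) \<omega> \<partial>M)"
    using nn_integral_Markov_inequality[of "\<lambda>\<omega>. ennreal (\<bar>f \<omega>\<bar> powr \<gamma>)" "space M" M "ennreal (x powr (- \<gamma>))"]
    by (simp add: Int_def conj_commute)
  also have "(\<integral>\<^sup>+\<omega>. ennreal (\<bar>f \<omega>\<bar> powr \<gamma>) * indicator (space M) \<omega> \<partial>M) = (\<integral>\<^sup>+\<omega>. ennreal (\<bar>f \<omega>\<bar> powr \<gamma>) \<partial>M)"
    by (intro nn_integral_cong) auto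
  also have "ennreal (x powr (- \<gamma>)) * \<dots> \<le> ennreal (x powr (- \<gamma>)) * ennreal C"
    by (rule mult_left_mono[OF le]) simp
  finally show ?thesis using C
    by (simp add: emeasure_eq_measure mult.commute flip: ennreal_mult)
qed

section \<open>Cadlag paths\<close>

text \<open>One-sided limits give local boundedness, and Bolzano's bisection principle spreads it
  over compact intervals.\<close>

lemma cadlag_on_nonneg_bounded:
  assumes f: "cadlag_on_nonneg f"
  shows "\<exists>B. \<forall>t\<in>{0..T}. \<bar>f t\<bar> \<le> B"
proof (cases "0 \<le> T")
  case True
  \<comment> \<open>The guard \<open>0 \<le> t\<close> lets small intervals around \<open>0\<close>
    reach into negative arguments, where nothing is known about \<open>f\<close>.\<close>
  define P where "P a b \<longleftrightarrow> (\<exists>B. \<forall>t\<in>{a..b}. 0 \<le> t \<longrightarrow> \<bar>f t\<bar> \<le> B)" for a b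
  have "P 0 T" using True
  proof (induction rule: Bolzano)
    case (trans a b c)
    then obtain B C where "\<forall>t\<in>{a..b}. 0 \<le> t \<longrightarrow> \<bar>f t\<bar> \<le> B" "\<forall>t\<in>{b..c}. 0 \<le> t \<longrightarrow> \<bar>f t\<bar> \<le> C" unfolding P_def by blast
    then have "\<bar>f t\<bar> \<le> max B C" if "t \<in> {a..c}" "0 \<le> t" for t
      using that by (cases "t \<le> b") (simp_all add: le_max_iff_disj)
    then show ?case unfolding P_def by blast
  next
    case (local x)
    have bdd: "\<exists>C. eventually (\<lambda>t. \<bar>f t\<bar> \<le> C) F" if "(f \<longlongrightarrow> l) F" for l F
    proof -
      have "((\<lambda>t. \<bar>f t\<bar>) \<longlongrightarrow> \<bar>l\<bar>) F" using that by (rule tendsto_rabs)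
      then have "eventually (\<lambda>t. \<bar>f t\<bar> < \<bar>l\<bar> + 1) F" by (rule order_tendstoD) simp
      then have "eventually (\<lambda>t. \<bar>f t\<bar> \<le> \<bar>l\<bar> + 1) F" by (rule eventually_mono) simp
      then show ?thesis by blast
    qed
    have "(f \<longlongrightarrow> f x) (at_right x)" using f local unfolding cadlag_on_nonneg_def by simp
    then obtain C1 where "eventually (\<lambda>t. \<bar>f t\<bar> \<le> C1) (at_right x)" using bdd by blast
    then obtain r where r: "r > x" "\<And>t. x < t \<Longrightarrow> t < r \<Longrightarrow> \<bar>f t\<bar> \<le> C1"
      unfolding eventually_at_right_field by auto
    have "\<exists>C l. l < x \<and> (\<forall>t. 0 \<le> t \<longrightarrow> l < t \<longrightarrow> t < x \<longrightarrow> \<bar>f t\<bar> \<le> C)"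
    proof (cases "x = 0")
      case True
      then show ?thesis by (intro exI[of _ 0] exI[of _ "-1"]) auto
    next
      case False
      then have "x > 0" using local by simp
      then obtain l where "(f \<longlongrightarrow> l) (at_left x)"
        using f unfolding cadlag_on_nonneg_def by blast
      then obtain C2 where "eventually (\<lambda>t. \<bar>f t\<bar> \<le> C2) (at_left x)" using bdd by blast
      then show ?thesis unfolding eventually_at_left_field by blast
    qed
    then obtain C l where l: "l < x" "\<And>t. 0 \<le> t \<Longrightarrow> l < t \<Longrightarrow> t < x \<Longrightarrow> \<bar>f t\<bar> \<le> C" by blast
    show ?case
    proof (intro exI[of _ "min (x - l) (r - x)"] conjI allI impI)
      show "0 < min (x - l) (r - x)" using r l by auto
      fix a b assume ab: "a \<le> x \<and> x \<le> b \<and> b - a < min (x - l) (r - x)"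
      have "\<bar>f t\<bar> \<le> max \<bar>f x\<bar> (max C C1)" if "t \<in> {a..b}" "0 \<le> t" for t
      proof (cases t x rule: linorder_cases)
        case less
        then show ?thesis using l(2)[of t] that ab by (auto simp: le_max_iff_disj)
      next
        case greater
        then show ?thesis using r(2)[of t] that ab by (auto simp: le_max_iff_disj)
      qed (auto simp: le_max_iff_disj)
      then show "P a b" unfolding P_def by blast
    qed
  qed
  then show ?thesis unfolding P_def by auto
qed auto

lemma cadlag_left_limit:
  assumes "cadlag_on_nonneg f" "u > 0"
  shows "(f \<longlongrightarrow> Lim (at_left u) f) (at_left u)"
  using assms unfolding cadlag_on_nonneg_def by (metis tendsto_Lim trivial_limit_at_left_real)

text \<open>Used with balls for \<open>S\<close>, to carry bounds on a path over to its left
  limits.\<close>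

lemma left_limit_mem_closed:
  assumes f: "cadlag_on_nonneg f" and u: "u > 0" "c < u" and S: "closed S" "\<And>v. c < v \<Longrightarrow> v < u \<Longrightarrow> f v \<in> S"
  shows "Lim (at_left u) f \<in> S"
proof (rule Lim_in_closed_set[OF S(1) _ _ cadlag_left_limit[OF f u(1)]])
  show "eventually (\<lambda>v. f v \<in> S) (at_left u)"
    unfolding eventually_at_left_field using u S(2) by blast
qed simp

lemma left_limit_tendsto_left:
  assumes f: "cadlag_on_nonneg f" and u: "u > 0"
  shows "((\<lambda>v. Lim (at_left v) f) \<longlongrightarrow> Lim (at_left u) f) (at_left u)"
proof (rule tendstoI)
  fix e :: real assume e: "e > 0"
  have "eventually (\<lambda>v. dist (f v) (Lim (at_left u) f) < e / 2) (at_left u)"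
    by (rule tendstoD[OF cadlag_left_limit[OF assms]]) (use e in simp)
  then obtain c where c: "c < u" "\<And>v. c < v \<Longrightarrow> v < u \<Longrightarrow> dist (f v) (Lim (at_left u) f) < e / 2"
    unfolding eventually_at_left_field by blast
  have "dist (Lim (at_left v) f) (Lim (at_left u) f) < e" if v: "max c 0 < v" "v < u" for v
  proof -
    have "Lim (at_left v) f \<in> cball (Lim (at_left u) f) (e / 2)"
      using v c(2) by (intro left_limit_mem_closed[OF f, of v "max c 0"])
        (auto simp: dist_commute less_imp_le)
    then show ?thesis using e by (auto simp: dist_commute)
  qed
  then show "eventually (\<lambda>v. dist (Lim (at_left v) f) (Lim (at_left u) f) < e) (at_left u)"
    unfolding eventually_at_left_field using c(1) u by (intro exI[of _ "max c 0"]) auto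
qed

text \<open>A cadlag path is thus recovered from its left limits, the only values of it that a
  time-changed path on the negative half-line shows.\<close>

lemma left_limit_tendsto_right:
  assumes f: "cadlag_on_nonneg f" and u: "u \<ge> 0"
  shows "((\<lambda>v. Lim (at_left v) f) \<longlongrightarrow> f u) (at_right u)"
proof (rule tendstoI)
  fix e :: real assume e: "e > 0"
  have "(f \<longlongrightarrow> f u) (at_right u)" using assms unfolding cadlag_on_nonneg_def by blast
  then have "eventually (\<lambda>v. dist (f v) (f u) < e / 2) (at_right u)"
    by (rule tendstoD) (use e in simp)
  then obtain c where c: "c > u" "\<And>v. u < v \<Longrightarrow> v < c \<Longrightarrow> dist (f v) (f u) < e / 2"
    unfolding eventually_at_right_field by blast
  have "dist (Lim (at_left v) f) (f u) < e" if v: "u < v" "v < c" for v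
  proof -
    have "Lim (at_left v) f \<in> cball (f u) (e / 2)"
      using v c(2) u by (intro left_limit_mem_closed[OF f, of v u])
        (auto simp: dist_commute less_imp_le)
    then show ?thesis using e by (auto simp: dist_commute)
  qed
  then show "eventually (\<lambda>v. dist (Lim (at_left v) f) (f u) < e) (at_right u)"
    unfolding eventually_at_right_field using c(1) by blast
qed

section \<open>Paths of two-sided processes\<close>

definition two_sided_path :: "(real \<Rightarrow> real) \<Rightarrow> (real \<Rightarrow> real) \<Rightarrow> real \<Rightarrow> real" where
  "two_sided_path f g t = (if t \<ge> 0 then f t else - Lim (at_left (- t)) g)"

lemma two_sided_path_bounded:
  assumes f: "cadlag_on_nonneg f" and g: "cadlag_on_nonneg g"
  shows "\<exists>B. \<forall>t\<in>{a..b}. \<bar>two_sided_path f g t\<bar> \<le> B"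
proof -
  obtain B where B: "\<forall>t\<in>{0..b}. \<bar>f t\<bar> \<le> B"
    using cadlag_on_nonneg_bounded[OF f] by blast
  obtain C where C: "\<forall>t\<in>{0..-a}. \<bar>g t\<bar> \<le> C"
    using cadlag_on_nonneg_bounded[OF g] by blast
  have "\<bar>Lim (at_left u) g\<bar> \<le> C" if "0 < u" "u \<le> -a" for u
  proof -
    have "Lim (at_left u) g \<in> cball 0 C"
      using C that by (intro left_limit_mem_closed[OF g, of u 0]) auto
    then show ?thesis by simp
  qed
  then have "\<bar>two_sided_path f g t\<bar> \<le> max B C" if "t \<in> {a..b}" for t
    using B that by (cases "t \<ge> 0") (simp_all add: two_sided_path_def le_max_iff_disj)
  then show ?thesis by blast
qed

lemma two_sided_path_right_continuous:
  assumes f: "cadlag_on_nonneg f" and g: "cadlag_on_nonneg g"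
  shows "(two_sided_path f g \<longlongrightarrow> two_sided_path f g t) (at_right t)"
proof (cases "t \<ge> 0")
  case True
  then have "(f \<longlongrightarrow> f t) (at_right t)" using f unfolding cadlag_on_nonneg_def by blast
  moreover have "eventually (\<lambda>s. f s = two_sided_path f g s) (at_right t)"
    unfolding eventually_at_right_field two_sided_path_def using True by (intro exI[of _ "t + 1"]) auto
  ultimately show ?thesis using True by (auto simp: two_sided_path_def elim: Lim_transform_eventually)
next
  case False
  \<comment> \<open>Reflection turns the left continuity of the left limits into right
    continuity.\<close>
  then have "((\<lambda>s. Lim (at_left (- s)) g) \<longlongrightarrow> Lim (at_left (- t)) g) (at_right t)"
    using left_limit_tendsto_left[OF g, of "-t"] by (simp add: at_left_minus filterlim_filtermap)
  then have "((\<lambda>s. - Lim (at_left (- s)) g) \<longlongrightarrow> two_sided_path f g t) (at_right t)"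
    using False unfolding two_sided_path_def by (auto intro: tendsto_minus)
  moreover have "eventually (\<lambda>s. - Lim (at_left (- s)) g = two_sided_path f g s) (at_right t)"
    unfolding eventually_at_right_field two_sided_path_def using False by (intro exI[of _ 0]) auto
  ultimately show ?thesis by (rule Lim_transform_eventually)
qed

section \<open>Integrals of one-sided limits\<close>

text \<open>The fundamental theorem of calculus, once per cell. The grid is counted downwards from
  \<open>b\<close> and the cells are closed on the left, so \<open>f j\<close> belongs to the cell
  whose right end is grid point \<open>j\<close>.\<close>

lemma has_integral_step_function:
  fixes f w w' :: "real \<Rightarrow> real"
  assumes h: "h > 0"
    and w: "\<And>t. b - real n * h \<le> t \<Longrightarrow> t \<le> b \<Longrightarrow> (w has_real_derivative w' t) (at t)"
    and g: "\<And>j t. b - real (Suc j) * h \<le> t \<Longrightarrow> t < b - real j * h \<Longrightarrow> g t = f j"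
  shows "((\<lambda>t. w' t * g t) has_integral
     (\<Sum>j<n. f j * (w (b - real j * h) - w (b - real (Suc j) * h)))) {b - real n * h..b}"
  using w
proof (induction n)
  case (Suc n)
  have "(w' has_integral (w (b - real n * h) - w (b - real (Suc n) * h))) {b - real (Suc n) * h..b - real n * h}"
  proof (rule fundamental_theorem_of_calculus)
    fix x assume "x \<in> {b - real (Suc n) * h..b - real n * h}"
    then have "b - real (Suc n) * h \<le> x" "x \<le> b - real n * h" by auto
    moreover have "real n * h \<ge> 0" using h by simp
    ultimately have "b - real (Suc n) * h \<le> x" "x \<le> b" by linarith+
    then have "(w has_real_derivative w' x) (at x)" by (rule Suc.prems)
    then show "(w has_vector_derivative w' x) (at x within {b - real (Suc n) * h..b - real n * h})"
      by (auto simp: has_real_derivative_iff_has_vector_derivative intro: has_vector_derivative_at_within)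
  qed (use h in \<open>simp add: algebra_simps\<close>)
  then have "((\<lambda>t. f n * w' t) has_integral (f n * (w (b - real n * h) - w (b - real (Suc n) * h))))
      {b - real (Suc n) * h..b - real n * h}"
    by (rule has_integral_mult_right)
  \<comment> \<open>On the closed cell, \<open>g\<close> can differ from \<open>f n\<close> only at
    the right end.\<close>
  then have 1: "((\<lambda>t. w' t * g t) has_integral (f n * (w (b - real n * h) - w (b - real (Suc n) * h))))
      {b - real (Suc n) * h..b - real n * h}"
    by (rule has_integral_spike_finite[of "{b - real n * h}", rotated 2])
      (use g[of n] in auto)
  have 2: "((\<lambda>t. w' t * g t) has_integral
     (\<Sum>j<n. f j * (w (b - real j * h) - w (b - real (Suc j) * h)))) {b - real n * h..b}"
    using h by (intro Suc.IH Suc.prems) (auto simp: algebra_simps)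
  have "((\<lambda>t. w' t * g t) has_integral (f n * (w (b - real n * h) - w (b - real (Suc n) * h)) +
     (\<Sum>j<n. f j * (w (b - real j * h) - w (b - real (Suc j) * h))))) {b - real (Suc n) * h..b}"
    by (rule has_integral_combine[OF _ _ 1 2]) (use h in \<open>auto simp: algebra_simps\<close>)
  then show ?case by (simp add: add.commute)
qed (simp add: has_integral_refl)

text \<open>The step functions use the values of \<open>f\<close> at grid points strictly to the right of the
  argument, so that only the right limits \<open>y\<close> of \<open>f\<close> are seen in the limit.\<close>

lemma step_sums_tendsto_integral:
  fixes f y w w' :: "real \<Rightarrow> real"
  assumes ab: "a < b"
    and lim: "\<And>t. a \<le> t \<Longrightarrow> t < b \<Longrightarrow> (f \<longlongrightarrow> y t) (at_right t)"
    and bd: "\<And>t. a \<le> t \<Longrightarrow> t \<le> b \<Longrightarrow> \<bar>f t\<bar> \<le> B"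
    and w: "\<And>t. a \<le> t \<Longrightarrow> t \<le> b \<Longrightarrow> (w has_real_derivative w' t) (at t)"
    and w': "continuous_on {a..b} w'"
  shows "(\<lambda>t. w' t * y t) integrable_on {a..b}"
    and "(\<lambda>n. \<Sum>j<n. f (b - real j * ((b - a) / real n)) *
        (w (b - real j * ((b - a) / real n)) - w (b - real (Suc j) * ((b - a) / real n))))
      \<longlonglongrightarrow> integral {a..b} (\<lambda>t. w' t * y t)"
proof -
  \<comment> \<open>The shift to \<open>Suc n\<close> avoids division by zero and is undone in the
    last step.\<close>
  define h where "h n = (b - a) / real (Suc n)" for n
  have h: "h n > 0" "real (Suc n) * h n = b - a" for n using ab by (auto simp: h_def)
  \<comment> \<open>The ceiling minus one is the largest integer strictly below
    \<open>(b - t) / h n\<close>, so \<open>p n t\<close> is the smallest grid point strictly to the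
    right of \<open>t\<close>.\<close>
  define p where "p n t = b - (of_int \<lceil>(b - t) / h n\<rceil> - 1) * h n" for n t
  have p_gt: "t < p n t" and p_le: "p n t \<le> t + h n" for n t
  proof -
    have "(of_int \<lceil>(b - t) / h n\<rceil> - 1) * h n < (b - t) / h n * h n"
      using h(1)[of n] by (intro mult_strict_right_mono) linarith+
    then show "t < p n t" using h(1)[of n] unfolding p_def by simp
    have "(b - t) / h n * h n \<le> of_int \<lceil>(b - t) / h n\<rceil> * h n"
      using h(1)[of n] by (intro mult_right_mono) auto
    moreover have "(b - t) / h n * h n = b - t" using h(1)[of n] by simp
    ultimately show "p n t \<le> t + h n" unfolding p_def by (simp add: algebra_simps)
  qed
  have p_b: "p n t \<le> b" if "t < b" for n t
  proof -
    have "(b - t) / h n > 0" using that h(1)[of n] by simp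
    then have "(of_int \<lceil>(b - t) / h n\<rceil>::real) \<ge> 1" by (simp add: int_one_le_iff_zero_less del: zero_less_divide_iff)
    then show ?thesis unfolding p_def using h(1)[of n] by simp
  qed
  have p_grid: "p n t = b - real j * h n"
    if "b - real (Suc j) * h n \<le> t" "t < b - real j * h n" for j n t
  proof -
    have "real j < (b - t) / h n" "(b - t) / h n \<le> real (Suc j)"
      using that h(1)[of n] by (simp_all add: field_simps)
    then have "\<lceil>(b - t) / h n\<rceil> = int (Suc j)" by (intro ceiling_unique) auto
    then show ?thesis unfolding p_def by simp
  qed
  have hn0: "h \<longlonglongrightarrow> 0" unfolding h_def by real_asymp
  \<comment> \<open>At \<open>t = b\<close> the point \<open>p n t\<close> would lie beyond
    \<open>b\<close>. The value \<open>0\<close> there changes no integral.\<close>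
  define g where "g n t = (if t < b then f (p n t) else 0)" for n t
  define z where "z t = (if t < b then y t else 0)" for t
  let ?S = "\<lambda>n. \<Sum>j<n. f (b - real j * ((b - a) / real n)) *
        (w (b - real j * ((b - a) / real n)) - w (b - real (Suc j) * ((b - a) / real n)))"
  have gi: "((\<lambda>t. w' t * g n t) has_integral ?S (Suc n)) {a..b}" for n
  proof -
    have "((\<lambda>t. w' t * g n t) has_integral (\<Sum>j<Suc n. f (b - real j * h n) *
        (w (b - real j * h n) - w (b - real (Suc j) * h n)))) {b - real (Suc n) * h n..b}"
    proof (rule has_integral_step_function[OF h(1)])
      fix t assume "b - real (Suc n) * h n \<le> t" "t \<le> b"
      then show "(w has_real_derivative w' t) (at t)" using w h(2)[of n] by auto
    next
      fix j t assume t: "b - real (Suc j) * h n \<le> t" "t < b - real j * h n"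
      have "t < b" using t(2) h(1)[of n] by (smt (verit) mult_nonneg_nonneg of_nat_0_le_iff)
      then show "g n t = f (b - real j * h n)" unfolding g_def using p_grid[OF t] by simp
    qed
    then show ?thesis unfolding h(2) unfolding h_def by simp
  qed
  have B0: "0 \<le> B" using bd[of b] ab by auto
  have conv: "(\<lambda>n. w' t * g n t) \<longlonglongrightarrow> w' t * z t" if t: "t \<in> {a..b}" for t
  proof (cases "t < b")
    case True
    have "(\<lambda>n. t + h n) \<longlonglongrightarrow> t + 0" by (intro tendsto_intros hn0)
    then have lim_h: "(\<lambda>n. t + h n) \<longlonglongrightarrow> t" by simp
    have "(\<lambda>n. p n t) \<longlonglongrightarrow> t"
      by (rule tendsto_sandwich[of "\<lambda>_. t" _ _ "\<lambda>n. t + h n"])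
        (simp_all add: p_le less_imp_le[OF p_gt] lim_h)
    then have "filterlim (\<lambda>n. p n t) (at_right t) sequentially"
      by (rule tendsto_imp_filterlim_at_right) (simp add: p_gt)
    then have "(\<lambda>n. f (p n t)) \<longlonglongrightarrow> y t"
      using filterlim_compose[OF lim] t True by auto
    then show ?thesis unfolding g_def z_def using True by (auto intro: tendsto_intros)
  qed (simp add: g_def z_def)
  have bound: "norm (w' t * g n t) \<le> \<bar>w' t\<bar> * B" if "t \<in> {a..b}" for n t
  proof -
    have "\<bar>g n t\<bar> \<le> B"
    proof (cases "t < b")
      case True
      then show ?thesis using that p_b[OF True, of n] p_gt[of t n] bd[of "p n t"] by (simp add: g_def)
    qed (simp add: g_def B0)
    then show ?thesis by (simp add: abs_mult mult_left_mono)
  qed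
  have hint: "(\<lambda>t. \<bar>w' t\<bar> * B) integrable_on {a..b}"
    by (intro integrable_continuous_interval continuous_intros w')
  have zi: "(\<lambda>t. w' t * z t) integrable_on {a..b}"
    and zl: "(\<lambda>n. integral {a..b} (\<lambda>t. w' t * g n t)) \<longlonglongrightarrow> integral {a..b} (\<lambda>t. w' t * z t)"
    using dominated_convergence[of "\<lambda>n t. w' t * g n t" "{a..b}" "\<lambda>t. \<bar>w' t\<bar> * B" "\<lambda>t. w' t * z t"]
      gi hint bound conv by (auto simp: has_integral_integrable)
  have eq: "y t = z t" if "t \<in> {a..b} - {b}" for t using that by (auto simp: z_def)
  show "(\<lambda>t. w' t * y t) integrable_on {a..b}"
    by (rule integrable_spike_finite[of "{b}", OF _ _ zi]) (use eq in auto)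
  have "integral {a..b} (\<lambda>t. w' t * y t) = integral {a..b} (\<lambda>t. w' t * z t)"
    by (rule integral_spike[of "{b}"]) (use eq in auto)
  moreover have "integral {a..b} (\<lambda>t. w' t * g n t) = ?S (Suc n)" for n
    using gi by (rule integral_unique)
  ultimately have "(\<lambda>n. ?S (Suc n)) \<longlonglongrightarrow> integral {a..b} (\<lambda>t. w' t * y t)" using zl by simp
  then show "?S \<longlonglongrightarrow> integral {a..b} (\<lambda>t. w' t * y t)" by (rule LIMSEQ_imp_Suc)
qed

text \<open>Maximum principle: the integral \<open>J\<close> formally solves \<open>J' = \<beta> (J + N)\<close> backwards from
  \<open>J 0 = 0\<close>, where \<open>N \<ge> - K\<close>, so it cannot rise above \<open>K\<close> when moving to the left.\<close>

lemma exp_weighted_integral_bound: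
  fixes y :: "real \<Rightarrow> real"
  assumes \<beta>: "\<beta> > 0"
    and int: "(\<lambda>t. \<beta> * exp (\<beta> * t) * y t) integrable_on {s..0}"
    and N: "\<And>t. s \<le> t \<Longrightarrow> t < 0 \<Longrightarrow>
      - exp (\<beta> * t) * y t - integral {t..0} (\<lambda>t. \<beta> * exp (\<beta> * t) * y t) \<ge> - K"
    and s: "s \<le> 0" and K: "K \<ge> 0"
  shows "integral {s..0} (\<lambda>t. \<beta> * exp (\<beta> * t) * y t) \<le> K"
proof (rule ccontr)
  define J where "J t = integral {t..0} (\<lambda>t. \<beta> * exp (\<beta> * t) * y t)" for t
  assume "\<not> ?thesis"
  then have Js: "J s > K" by (simp add: J_def)
  have J0: "J 0 = 0" by (simp add: J_def)
  have cont: "continuous_on {s..0} J" unfolding J_def by (rule indefinite_integral_continuous_1'[OF int])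
  \<comment> \<open>Let \<open>r\<close> be the leftmost point with \<open>J r \<le> K\<close>. To
    the left of \<open>r\<close> one has \<open>J > K\<close>, so \<open>N\<close> forces
    \<open>y \<le> 0\<close> there; then \<open>J s \<le> J r \<le> K\<close>, a
    contradiction.\<close>
  define A where "A = {s..0} \<inter> J -` {..K}"
  have "closed A" unfolding A_def by (intro continuous_closed_preimage cont) auto
  then have "compact ({s..0} \<inter> A)" by (intro compact_Int_closed) auto
  then have "compact A" by (simp add: A_def Int_assoc[symmetric])
  moreover have "A \<noteq> {}" unfolding A_def using J0 K s by auto
  ultimately obtain r where r: "r \<in> A" "\<And>t. t \<in> A \<Longrightarrow> r \<le> t" using compact_attains_inf[of A] by blast
  have rs: "s \<le> r" "r \<le> 0" "J r \<le> K" using r(1) by (auto simp: A_def)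
  have above: "J t > K" if "s \<le> t" "t < r" for t
    using r(2)[of t] that rs by (force simp: A_def)
  have "J s = integral {s..r} (\<lambda>t. \<beta> * exp (\<beta> * t) * y t) + J r"
    unfolding J_def using Henstock_Kurzweil_Integration.integral_combine[OF rs(1,2) int] by simp
  moreover have "integral {s..r} (\<lambda>t. \<beta> * exp (\<beta> * t) * y t) \<le> 0"
  proof -
    \<comment> \<open>The sign of \<open>y\<close> is known only strictly to the left of
      \<open>r\<close>.\<close>
    define z where "z t = (if t < r then \<beta> * exp (\<beta> * t) * y t else 0)" for t
    have "z t \<le> 0" if t: "t \<in> {s..r}" for t
    proof (cases "t < r")
      case True
      have "exp (\<beta> * t) * y t \<le> K - J t" using N[of t] t True rs unfolding J_def by simp
      also have "\<dots> \<le> 0" using above[of t] t True by simp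
      finally show ?thesis using True \<beta> by (simp add: z_def mult.assoc mult_nonneg_nonpos)
    qed (simp add: z_def)
    moreover have "z integrable_on {s..r}"
    proof (rule integrable_spike_finite[of "{r}"])
      show "(\<lambda>t. \<beta> * exp (\<beta> * t) * y t) integrable_on {s..r}"
        by (rule integrable_on_subinterval[OF int]) (use rs in auto)
    qed (auto simp: z_def)
    ultimately have "integral {s..r} z \<le> integral {s..r} (\<lambda>_. 0)"
      by (intro integral_le) auto
    moreover have "integral {s..r} (\<lambda>t. \<beta> * exp (\<beta> * t) * y t) = integral {s..r} z"
      by (rule integral_spike[of "{r}"]) (auto simp: z_def)
    ultimately show ?thesis by simp
  qed
  ultimately show False using Js rs(3) by simp
qed

text \<open>Adding the dominating exponential \<open>e\<close> makes the integrand nonnegative to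
  the left of \<open>c\<close>. The integrals of \<open>f + e\<close> are then monotone in the lower
  limit and bounded by means of the integral of \<open>2 * e\<close>; subtracting the explicit
  integral of \<open>e\<close> leaves the claim.\<close>

lemma improper_integral_at_bot_converges:
  fixes f :: "real \<Rightarrow> real"
  assumes int: "\<And>a. f integrable_on {a..b}"
    and bd: "\<And>t. t \<le> c \<Longrightarrow> \<bar>f t\<bar> \<le> C * exp (\<epsilon> * t)" and \<epsilon>: "\<epsilon> > 0"
  shows "\<exists>l. ((\<lambda>a. integral {a..b} f) \<longlongrightarrow> l) at_bot"
proof -
  define c' where "c' = min c b"
  define e where "e t = C * exp (\<epsilon> * t)" for t
  define E where "E t = C / \<epsilon> * exp (\<epsilon> * t)" for t
  have ei: "(e has_integral (E y - E x)) {x..y}" if "x \<le> y" for x y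
    unfolding e_def E_def using that \<epsilon>
    by (intro fundamental_theorem_of_calculus)
      (auto intro!: derivative_eq_intros simp: has_real_derivative_iff_has_vector_derivative[symmetric])
  have e_int: "integral {x..y} e = E y - E x" if "x \<le> y" for x y
    using ei[OF that] by (rule integral_unique)
  have e_on: "e integrable_on {x..y}" for x y
    using ei[of x y] by (cases "x \<le> y") (auto simp: has_integral_integrable)
  have C: "C \<ge> 0" using bd[of c] by (smt (verit) exp_gt_zero mult_neg_pos)
  have f_on: "f integrable_on {x..y}" if "y \<le> b" for x y
    by (rule integrable_on_subinterval[OF int[of x]]) (use that in auto)
  \<comment> \<open>Cutting the lower limit off at \<open>c'\<close> makes \<open>G\<close> monotone
    on the whole line, being constant as long as \<open>- x \<ge> c'\<close>.\<close>
  define G where "G x = integral {min c' (- x)..b} (\<lambda>t. f t + e t)" for x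
  have G_eq: "G x = integral {min c' (- x)..b} f + (E b - E (min c' (- x)))" for x
  proof -
    have "min c' (- x) \<le> b" unfolding c'_def by auto
    then show ?thesis unfolding G_def
      using int e_on e_int by (subst Henstock_Kurzweil_Integration.integral_add) auto
  qed
  have sum_on: "(\<lambda>t. f t + e t) integrable_on {x..y}" if "y \<le> b" for x y
    using f_on[OF that] e_on by (rule integrable_add)
  have diff: "G y - G x = integral {min c' (- y)..min c' (- x)} (\<lambda>t. f t + e t)" if "x \<le> y" for x y
  proof -
    have 1: "min c' (- y) \<le> min c' (- x)" "min c' (- x) \<le> b" using that by (auto simp: c'_def)
    show ?thesis unfolding G_def
      using Henstock_Kurzweil_Integration.integral_combine[OF 1 sum_on[OF order_refl]] by simp
  qed
  have mono: "mono G"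
  proof (rule monoI)
    fix x y :: real assume "x \<le> y"
    have "0 \<le> integral {min c' (- y)..min c' (- x)} (\<lambda>t. f t + e t)"
    proof (rule integral_nonneg[OF sum_on])
      show "min c' (- x) \<le> b" by (auto simp: c'_def)
      fix t assume "t \<in> {min c' (- y)..min c' (- x)}"
      then have "t \<le> c" by (auto simp: c'_def)
      from bd[OF this] show "0 \<le> f t + e t" unfolding e_def by auto
    qed
    then show "G x \<le> G y" using diff[OF \<open>x \<le> y\<close>] by simp
  qed
  have bound: "G (real n) \<le> G 0 + 2 * E (min c' 0)" for n
  proof -
    have le: "min c' (- real n) \<le> min c' 0" by auto
    have "integral {min c' (- real n)..min c' (- 0)} (\<lambda>t. f t + e t)
       \<le> integral {min c' (- real n)..min c' (- 0)} (\<lambda>t. 2 * e t)"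
    proof (rule integral_le[OF sum_on])
      show "min c' (- 0) \<le> b" by (auto simp: c'_def)
      show "(\<lambda>t. 2 * e t) integrable_on {min c' (- real n)..min c' (- 0)}"
        by (intro integrable_on_mult_right e_on)
      fix t assume "t \<in> {min c' (- real n)..min c' (- 0)}"
      then have "t \<le> c" by (auto simp: c'_def)
      from bd[OF this] show "f t + e t \<le> 2 * e t" unfolding e_def by auto
    qed
    also have "\<dots> = 2 * (E (min c' 0) - E (min c' (- real n)))"
      using e_int[OF le] by simp
    also have "\<dots> \<le> 2 * E (min c' 0)" using C \<epsilon> by (simp add: E_def)
    finally show ?thesis using diff[of 0 "real n"] by simp
  qed
  have "incseq (\<lambda>n. G (real n))" using mono by (simp add: mono_def)
  then obtain l where "(\<lambda>n. G (real n)) \<longlonglongrightarrow> l"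
    using incseq_convergent bound by blast
  then have "(G \<longlongrightarrow> l) at_top" using mono by (intro tendsto_at_topI_sequentially_real) auto
  then have Gl: "((\<lambda>a. G (- a)) \<longlongrightarrow> l) at_bot"
    by (simp add: at_top_mirror filterlim_filtermap)
  have "((\<lambda>a. E a) \<longlongrightarrow> 0) at_bot" unfolding E_def using \<epsilon> by real_asymp
  then have "((\<lambda>a. G (- a) - E b + E a) \<longlongrightarrow> l - E b + 0) at_bot"
    by (intro tendsto_intros Gl)
  moreover have "eventually (\<lambda>a. G (- a) - E b + E a = integral {a..b} f) at_bot"
    using eventually_le_at_bot[of c'] by eventually_elim (simp add: G_eq min_absorb2)
  ultimately show ?thesis by (blast intro: Lim_transform_eventually)
qed

section \<open>Integrals along a time-changed path\<close>

text \<open>The random integral of \<open>exp (\<beta> * t)\<close> over \<open>[s, 0]\<close> against a path whose value at \<open>0\<close>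
  is \<open>0\<close>; the increments below are the summands of its approximating sums.\<close>

definition weighted_integral :: "real \<Rightarrow> (real \<Rightarrow> real) \<Rightarrow> real \<Rightarrow> real" where
  "weighted_integral \<beta> y s = - exp (\<beta> * s) * y s - integral {s..0} (\<lambda>t. \<beta> * exp (\<beta> * t) * y t)"

definition weighted_increments :: "real \<Rightarrow> (real \<Rightarrow> real) \<Rightarrow> (real \<Rightarrow> real) \<Rightarrow> real \<Rightarrow> nat \<Rightarrow> nat \<Rightarrow> real" where
  "weighted_increments \<beta> f V s n i = exp (\<beta> * (s * real (Suc i) / real n)) *
     (f (V (s * real (Suc i) / real n)) - f (V (s * real i / real n)))"

text \<open>\<open>V\<close> is a clock running backwards: in the application \<open>V t\<close> is
  minus the argument at which the two-sided process is read, and \<open>- R\<close> is the left end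
  of the interval on which moments are controlled.\<close>

locale time_change =
  fixes V :: "real \<Rightarrow> real" and R :: real
  assumes V_0: "V 0 = 0"
    and V_less: "\<And>s t. - R \<le> s \<Longrightarrow> s < t \<Longrightarrow> t \<le> 0 \<Longrightarrow> V t < V s"
    and V_cont: "continuous_on {- R..0} V"
begin

lemma V_le: "- R \<le> s \<Longrightarrow> s \<le> t \<Longrightarrow> t \<le> 0 \<Longrightarrow> V t \<le> V s"
  using V_less[of s t] by (cases "s = t") auto

lemma V_pos: "- R \<le> t \<Longrightarrow> t < 0 \<Longrightarrow> 0 < V t"
  using V_less[of t 0] V_0 by simp

text \<open>Because \<open>V\<close> decreases strictly, moving to the right in \<open>t\<close>
  approaches \<open>V t\<close> strictly from below. This is how left limits of \<open>f\<close>
  become right limits of the time-changed path.\<close>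

lemma filterlim_V:
  assumes t: "- R \<le> t" "t < 0"
  shows "filterlim V (at_left (V t)) (at_right t)"
proof (rule tendsto_imp_filterlim_at_left)
  have "(V \<longlongrightarrow> V t) (at t within {- R..0})" using V_cont t unfolding continuous_on_def by auto
  then have "(V \<longlongrightarrow> V t) (at t within {t..0})" by (rule tendsto_within_subset) (use t in auto)
  then show "(V \<longlongrightarrow> V t) (at_right t)"
    using t by (simp add: at_within_Icc_at_right)
  show "eventually (\<lambda>s. V s < V t) (at_right t)"
    unfolding eventually_at_right_field using t V_less[of t] by (intro exI[of _ 0]) auto
qed

context
  fixes f \<psi> :: "real \<Rightarrow> real"
  assumes f: "cadlag_on_nonneg f" and f0: "f 0 = 0"
    and \<psi>: "\<And>t. - R \<le> t \<Longrightarrow> t < 0 \<Longrightarrow> \<psi> t = - Lim (at_left (V t)) f"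
begin

lemma time_changed_right_limit:
  assumes t: "- R \<le> t" "t < 0"
  shows "((\<lambda>s. - f (V s)) \<longlongrightarrow> \<psi> t) (at_right t)"
  unfolding \<psi>[OF t]
  by (intro tendsto_minus filterlim_compose[OF cadlag_left_limit[OF f V_pos[OF t]] filterlim_V[OF t]])

lemma time_changed_right_continuous:
  assumes t: "- R \<le> t" "t < 0"
  shows "(\<psi> \<longlongrightarrow> \<psi> t) (at_right t)"
proof (rule Lim_transform_eventually)
  show "((\<lambda>s. - Lim (at_left (V s)) f) \<longlongrightarrow> \<psi> t) (at_right t)"
    unfolding \<psi>[OF t]
    by (intro tendsto_minus filterlim_compose[OF left_limit_tendsto_left[OF f V_pos[OF t]] filterlim_V[OF t]])
  show "eventually (\<lambda>s. - Lim (at_left (V s)) f = \<psi> s) (at_right t)"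
    unfolding eventually_at_right_field using t \<psi> by (intro exI[of _ 0]) auto
qed

lemma time_changed_bounded: "\<exists>B. \<forall>t\<in>{- R..0}. \<bar>- f (V t)\<bar> \<le> B"
proof -
  obtain B where "\<forall>u\<in>{0..V (- R)}. \<bar>f u\<bar> \<le> B" using cadlag_on_nonneg_bounded[OF f] by blast
  moreover have "V t \<in> {0..V (- R)}" if "t \<in> {- R..0}" for t
    using V_le[of t 0] V_le[of "- R" t] V_0 that by auto
  ultimately have "\<forall>t\<in>{- R..0}. \<bar>- f (V t)\<bar> \<le> B" by simp
  then show ?thesis by blast
qed

lemma time_changed_step_sums:
  assumes s: "- R \<le> s" "s < 0"
  shows "(\<lambda>t. \<beta> * exp (\<beta> * t) * \<psi> t) integrable_on {s..0}"
    and "(\<lambda>n. \<Sum>j<n. - f (V (s * real j / real n)) *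
        (exp (\<beta> * (s * real j / real n)) - exp (\<beta> * (s * real (Suc j) / real n))))
      \<longlonglongrightarrow> integral {s..0} (\<lambda>t. \<beta> * exp (\<beta> * t) * \<psi> t)"
proof -
  obtain B where B: "\<forall>t\<in>{- R..0}. \<bar>- f (V t)\<bar> \<le> B" using time_changed_bounded by blast
  have 1: "((\<lambda>t. exp (\<beta> * t)) has_real_derivative \<beta> * exp (\<beta> * t)) (at t)" for t
    by (auto intro!: derivative_eq_intros)
  have 2: "continuous_on {s..0} (\<lambda>t. \<beta> * exp (\<beta> * t))" by (intro continuous_intros)
  have 3: "((\<lambda>t. - f (V t)) \<longlongrightarrow> \<psi> t) (at_right t)" if "s \<le> t" "t < 0" for t
    using time_changed_right_limit that s by auto
  have 4: "\<bar>- f (V t)\<bar> \<le> B" if "s \<le> t" "t \<le> 0" for t using B that s by auto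
  note * = step_sums_tendsto_integral[of s 0 "\<lambda>t. - f (V t)" \<psi> B "\<lambda>t. exp (\<beta> * t)" "\<lambda>t. \<beta> * exp (\<beta> * t)",
      OF s(2) 3 4 1 2]
  show "(\<lambda>t. \<beta> * exp (\<beta> * t) * \<psi> t) integrable_on {s..0}" by (rule *(1))
  have "0 - real j * ((0 - s) / real n) = s * real j / real n" for j n by (simp add: mult.commute)
  then show "(\<lambda>n. \<Sum>j<n. - f (V (s * real j / real n)) *
        (exp (\<beta> * (s * real j / real n)) - exp (\<beta> * (s * real (Suc j) / real n))))
      \<longlonglongrightarrow> integral {s..0} (\<lambda>t. \<beta> * exp (\<beta> * t) * \<psi> t)" using *(2) by (simp only:)
qed

text \<open>Summation by parts turns the sum of weighted increments into a boundary term and the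
  step sums for the integral. The last increment is left out: with it the boundary term would
  contain \<open>f (V s)\<close> instead of the left limit hidden in
  \<open>\<psi> s\<close>.\<close>

lemma weighted_increments_tendsto:
  assumes s: "- R \<le> s" "s < 0"
  shows "(\<lambda>n. \<Sum>i<n - 1. weighted_increments \<beta> f V s n i) \<longlonglongrightarrow> weighted_integral \<beta> \<psi> s"
proof -
  define r where "r n j = s * real j / real (Suc n)" for n j
  have abel: "(\<Sum>i<n. w (Suc i) * (g (Suc i) - g i)) =
     w 0 * (- g 0) - w (Suc n) * (- g n) - (\<Sum>j<Suc n. - g j * (w j - w (Suc j)))" for n and w g :: "nat \<Rightarrow> real"
    by (induction n) (simp_all add: algebra_simps)
  \<comment> \<open>The last grid point used lies strictly to the right of \<open>s\<close>, so
    \<open>- f (V (r n n))\<close> tends to \<open>\<psi> s\<close>.\<close>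
  have "(\<lambda>n. r n n) \<longlonglongrightarrow> s" unfolding r_def by real_asymp
  moreover have "r n n > s" for n
    unfolding r_def using s by (simp add: field_simps)
  ultimately have "filterlim (\<lambda>n. r n n) (at_right s) sequentially"
    by (intro tendsto_imp_filterlim_at_right) auto
  from filterlim_compose[OF time_changed_right_limit[OF s] this]
  have "(\<lambda>n. - f (V (r n n))) \<longlonglongrightarrow> \<psi> s" .
  then have "(\<lambda>n. 0 - exp (\<beta> * s) * - f (V (r n n)) - (\<Sum>j<Suc n. - f (V (r n j)) *
        (exp (\<beta> * r n j) - exp (\<beta> * r n (Suc j))))) \<longlonglongrightarrow>
     0 - exp (\<beta> * s) * \<psi> s - integral {s..0} (\<lambda>t. \<beta> * exp (\<beta> * t) * \<psi> t)"
    using LIMSEQ_Suc[OF time_changed_step_sums(2)[OF s]]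
    unfolding r_def by (intro tendsto_intros)
  moreover have "(\<Sum>i<Suc n - 1. weighted_increments \<beta> f V s (Suc n) i) =
     0 - exp (\<beta> * s) * - f (V (r n n)) - (\<Sum>j<Suc n. - f (V (r n j)) *
        (exp (\<beta> * r n j) - exp (\<beta> * r n (Suc j))))" for n
    using abel[of "\<lambda>j. exp (\<beta> * r n j)" "\<lambda>j. f (V (r n j))" n]
    by (simp add: weighted_increments_def r_def V_0 f0)
  ultimately have "(\<lambda>n. \<Sum>i<Suc n - 1. weighted_increments \<beta> f V s (Suc n) i) \<longlonglongrightarrow> weighted_integral \<beta> \<psi> s"
    by (simp add: weighted_integral_def)
  then show ?thesis by (rule LIMSEQ_imp_Suc)
qed

lemma weighted_integral_right_continuous:
  assumes s: "- R \<le> s" "s < 0"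
  shows "(weighted_integral \<beta> \<psi> \<longlongrightarrow> weighted_integral \<beta> \<psi> s) (at_right s)"
proof -
  have "continuous_on {s..0} (\<lambda>x. integral {x..0} (\<lambda>t. \<beta> * exp (\<beta> * t) * \<psi> t))"
    by (rule indefinite_integral_continuous_1'[OF time_changed_step_sums(1)[OF s]])
  then have "((\<lambda>x. integral {x..0} (\<lambda>t. \<beta> * exp (\<beta> * t) * \<psi> t)) \<longlongrightarrow>
      integral {s..0} (\<lambda>t. \<beta> * exp (\<beta> * t) * \<psi> t)) (at s within {s..0})"
    using s by (simp add: continuous_on_def)
  then have 1: "((\<lambda>x. integral {x..0} (\<lambda>t. \<beta> * exp (\<beta> * t) * \<psi> t)) \<longlongrightarrow>
      integral {s..0} (\<lambda>t. \<beta> * exp (\<beta> * t) * \<psi> t)) (at_right s)"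
    using s by (simp add: at_within_Icc_at_right)
  show ?thesis
    unfolding weighted_integral_def by (intro tendsto_intros 1 time_changed_right_continuous s)
qed

text \<open>Right continuity extends the bound from dyadic points to the whole window. The maximum
  principle, applied to \<open>\<psi>\<close> and \<open>- \<psi>\<close>, bounds the integral part
  by \<open>K\<close>, so that \<open>exp (\<beta> * s) * \<bar>\<psi> s\<bar> \<le> 2 * K\<close>.
  Finally \<open>f u\<close> is a limit of left limits, all of which occur as values of
  \<open>- \<psi>\<close>.\<close>

lemma bound_from_weighted_integral:
  assumes \<beta>: "\<beta> > 0" and R: "R > 0"
    and dense: "\<And>n c. c \<in> {1..2 ^ n} \<Longrightarrow> \<bar>weighted_integral \<beta> \<psi> (- R * real c / 2 ^ n)\<bar> \<le> K"
    and u: "0 \<le> u" "u < V (- R)"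
  shows "\<bar>f u\<bar> \<le> 2 * exp (\<beta> * R) * K"
proof -
  have wb: "\<bar>weighted_integral \<beta> \<psi> s\<bar> \<le> K" if s: "- R \<le> s" "s < 0" for s
  proof -
    \<comment> \<open>The largest integer strictly below \<open>- s / R * 2 ^ n\<close>; hence
      \<open>r n\<close> is the first dyadic point strictly to the right of
      \<open>s\<close>.\<close>
    define c where "c n = nat \<lceil>- s / R * 2 ^ n\<rceil> - 1" for n :: nat
    define r where "r n = - R * real (c n) / 2 ^ n" for n
    have c: "real (c n) < - s / R * 2 ^ n" "- s / R * 2 ^ n \<le> real (c n) + 1" for n
    proof -
      have "0 < - s / R * 2 ^ n" using s R by (intro mult_pos_pos divide_pos_pos) auto
      then have "1 \<le> \<lceil>- s / R * 2 ^ n\<rceil>" by (simp add: int_one_le_iff_zero_less)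
      then have "int (c n) = \<lceil>- s / R * 2 ^ n\<rceil> - 1" unfolding c_def by linarith
      then have "real (c n) = of_int \<lceil>- s / R * 2 ^ n\<rceil> - 1" by linarith
      then show "real (c n) < - s / R * 2 ^ n" "- s / R * 2 ^ n \<le> real (c n) + 1"
        by linarith+
    qed
    have r_gt: "r n > s" for n
      using c(1)[of n] R unfolding r_def by (simp add: field_simps)
    have r_le: "r n \<le> s + R / 2 ^ n" for n
      using c(2)[of n] R unfolding r_def by (simp add: field_simps)
    have "(\<lambda>n. s + R / 2 ^ n) \<longlonglongrightarrow> s" by real_asymp
    then have rl: "r \<longlonglongrightarrow> s"
      by (rule tendsto_sandwich[of "\<lambda>_. s", rotated 3]) (simp_all add: less_imp_le[OF r_gt] r_le)
    then have "filterlim r (at_right s) sequentially"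
      by (rule tendsto_imp_filterlim_at_right) (simp add: r_gt)
    from filterlim_compose[OF weighted_integral_right_continuous[OF s] this]
    have "(\<lambda>n. \<bar>weighted_integral \<beta> \<psi> (r n)\<bar>) \<longlonglongrightarrow> \<bar>weighted_integral \<beta> \<psi> s\<bar>" by (rule tendsto_rabs)
    moreover have "eventually (\<lambda>n. \<bar>weighted_integral \<beta> \<psi> (r n)\<bar> \<le> K) sequentially"
    proof -
      have "eventually (\<lambda>n. r n < 0) sequentially" using rl s(2) by (rule order_tendstoD)
      then show ?thesis
      proof eventually_elim
        case (elim n)
        have "- s / R \<le> 1" using s R by (subst pos_divide_le_eq) auto
        then have "- s / R * 2 ^ n \<le> 1 * 2 ^ n" by (intro mult_right_mono) auto
        then have "real (c n) \<le> real (2 ^ n)" using c(1)[of n] unfolding of_nat_power of_nat_numeral by linarith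
        then have "c n \<le> 2 ^ n" by (simp only: of_nat_le_iff)
        moreover have "c n \<noteq> 0" using elim unfolding r_def by (intro notI) simp
        ultimately show ?case unfolding r_def by (intro dense) auto
      qed
    qed
    ultimately show ?thesis by (rule tendsto_upperbound) simp
  qed
  have K: "K \<ge> 0" using wb[of "-R"] R by auto
  have \<psi>b: "\<bar>\<psi> s\<bar> \<le> 2 * exp (\<beta> * R) * K" if s: "- R \<le> s" "s < 0" for s
  proof -
    let ?J = "\<lambda>y. integral {s..0} (\<lambda>t. \<beta> * exp (\<beta> * t) * y t)"
    have int: "(\<lambda>t. \<beta> * exp (\<beta> * t) * \<psi> t) integrable_on {s..0}" by (rule time_changed_step_sums(1)[OF s])
    have "?J \<psi> \<le> K"
    proof (rule exp_weighted_integral_bound[OF \<beta> int _ _ K])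
      fix t assume "s \<le> t" "t < 0"
      then show "- K \<le> - exp (\<beta> * t) * \<psi> t - integral {t..0} (\<lambda>t. \<beta> * exp (\<beta> * t) * \<psi> t)"
        using wb[of t] s unfolding weighted_integral_def by auto
    qed (use s in simp)
    moreover have "?J (\<lambda>t. - \<psi> t) \<le> K"
    proof (rule exp_weighted_integral_bound[OF \<beta> _ _ _ K])
      show "(\<lambda>t. \<beta> * exp (\<beta> * t) * - \<psi> t) integrable_on {s..0}"
        using integrable_neg[OF int] by simp
      fix t assume "s \<le> t" "t < 0"
      then show "- K \<le> - exp (\<beta> * t) * - \<psi> t - integral {t..0} (\<lambda>t. \<beta> * exp (\<beta> * t) * - \<psi> t)"
        using wb[of t] s unfolding weighted_integral_def by auto
    qed (use s in simp)
    ultimately have J: "\<bar>?J \<psi>\<bar> \<le> K" by auto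
    have "exp (\<beta> * s) * \<bar>\<psi> s\<bar> = \<bar>exp (\<beta> * s) * \<psi> s\<bar>" by (simp add: abs_mult)
    also have "\<dots> \<le> 2 * K" using J wb[OF s] unfolding weighted_integral_def by auto
    finally have *: "exp (\<beta> * s) * \<bar>\<psi> s\<bar> \<le> 2 * K" .
    have "\<beta> * - R \<le> \<beta> * s" using s \<beta> by (intro mult_left_mono) auto
    then have "1 \<le> exp (\<beta> * R) * exp (\<beta> * s)" by (simp flip: exp_add)
    then have "1 * \<bar>\<psi> s\<bar> \<le> exp (\<beta> * R) * exp (\<beta> * s) * \<bar>\<psi> s\<bar>"
      by (rule mult_right_mono) simp
    also have "\<dots> \<le> exp (\<beta> * R) * (2 * K)"
      using * unfolding mult.assoc by (rule mult_left_mono) simp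
    finally show ?thesis by simp
  qed
  have "((\<lambda>v. \<bar>Lim (at_left v) f\<bar>) \<longlongrightarrow> \<bar>f u\<bar>) (at_right u)"
    by (intro tendsto_rabs left_limit_tendsto_right[OF f u(1)])
  moreover have "eventually (\<lambda>v. \<bar>Lim (at_left v) f\<bar> \<le> 2 * exp (\<beta> * R) * K) (at_right u)"
    unfolding eventually_at_right_field
  proof (intro exI[of _ "V (- R)"] conjI allI impI u(2))
    \<comment> \<open>By the intermediate value theorem \<open>v\<close> is a clock value
      \<open>V t\<close>, and the left limit at \<open>v\<close> is
      \<open>- \<psi> t\<close>.\<close>
    fix v assume v: "u < v" "v < V (- R)"
    have "\<exists>t. - R \<le> t \<and> t \<le> 0 \<and> V t = v"
      using IVT2'[of V 0 v "- R"] v u(1) R V_0 V_cont by auto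
    then obtain t where t: "- R \<le> t" "t \<le> 0" "V t = v" by blast
    then have "t < 0" using v u(1) V_0 by (cases "t = 0") auto
    then show "\<bar>Lim (at_left v) f\<bar> \<le> 2 * exp (\<beta> * R) * K" using \<psi>[of t] \<psi>b[of t] t by simp
  qed
  ultimately show ?thesis by (rule tendsto_upperbound) simp
qed

end

end

section \<open>Tails and growth of Levy processes\<close>

context levy_process
begin

text \<open>Since \<open>s < 0\<close> and \<open>V\<close> decreases, the clock times increase with
  \<open>i\<close>, starting from \<open>V 0 = 0\<close>.\<close>

lemma weighted_increments_indep:
  assumes "time_change V R" and s: "- R \<le> s" "s < 0"
  shows "indep_vars (\<lambda>_. borel) (\<lambda>i \<omega>. weighted_increments \<beta> (\<lambda>u. X u \<omega>) V s n i) {..<n}"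
proof -
  interpret time_change V R by fact
  define t where "t i = V (s * real i / real n)" for i
  have inc: "t i < t (Suc i)" if "i < n" for i
  proof -
    have "s * real (Suc i) / real n < s * real i / real n"
      using that s by (intro divide_strict_right_mono mult_strict_left_mono_neg) auto
    moreover have "s * real i / real n \<le> 0" using s by (simp add: divide_nonpos_nonneg mult_nonpos_nonneg)
    moreover have "s \<le> s * real (Suc i) / real n"
    proof -
      have "s * real n \<le> s * real (Suc i)" using that s by (intro mult_left_mono_neg) auto
      then show ?thesis using that by (simp add: field_simps)
    qed
    ultimately show ?thesis unfolding t_def using s by (intro V_less) auto
  qed
  have "indep_vars (\<lambda>_. borel) (\<lambda>i \<omega>. X (t (Suc i)) \<omega> - X (t i) \<omega>) {..<n}"
    by (rule indep_increments[where t = t]) (auto simp: t_def[of 0] V_0 inc)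
  then have "indep_vars (\<lambda>_. borel) (\<lambda>i \<omega>. exp (\<beta> * (s * real (Suc i) / real n)) * (X (t (Suc i)) \<omega> - X (t i) \<omega>)) {..<n}"
    by (rule indep_vars_compose2) auto
  then show ?thesis by (simp add: weighted_increments_def t_def)
qed

text \<open>Markov's inequality gives the tail of each weighted integral, and Etemadi's inequality
  the tail of their maximum over dyadic points. The factor \<open>6 * exp (\<beta> * R)\<close> is
  the \<open>3\<close> of Etemadi's inequality times the \<open>2 * exp (\<beta> * R)\<close> lost
  in recovering the path from these integrals.\<close>

lemma tail_from_weighted_integral_moments:
  assumes "time_change V R" and R: "R > 0" and \<beta>: "\<beta> > 0" and \<gamma>: "\<gamma> > 0" and C: "C \<ge> 0"
    and \<psi>: "\<And>t \<omega>. - R \<le> t \<Longrightarrow> t < 0 \<Longrightarrow> \<omega> \<in> space M \<Longrightarrow> \<psi> \<omega> t = - Lim (at_left (V t)) (\<lambda>u. X u \<omega>)"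
    and mom: "\<And>s. - R \<le> s \<Longrightarrow> s < 0 \<Longrightarrow>
       (\<integral>\<^sup>+\<omega>. ennreal (\<bar>weighted_integral \<beta> (\<psi> \<omega>) s\<bar> powr \<gamma>) \<partial>M) \<le> ennreal C"
    and x: "x > 0" and u: "0 \<le> u" "u < V (- R)"
  shows "prob {\<omega>\<in>space M. \<bar>X u \<omega>\<bar> > 6 * exp (\<beta> * R) * x} \<le> 3 * (C * x powr (- \<gamma>))"
proof -
  interpret time_change V R by fact
  define S where "S s n \<omega> = (\<Sum>i<n - 1. weighted_increments \<beta> (\<lambda>u. X u \<omega>) V s n i)" for s n \<omega>
  \<comment> \<open>A measurable version of the weighted integral, which need not be measurable itself.\<close>
  define J where "J s \<omega> = lim (\<lambda>n. S s n \<omega>)" for s \<omega>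
  have J_rv[measurable]: "random_variable borel (J s)" if s: "- R \<le> s" "s < 0" for s
  proof -
    have "random_variable borel (S s n)" for n
      unfolding S_def using weighted_increments_indep[OF \<open>time_change V R\<close> s, of \<beta> n]
      by (intro borel_measurable_sum) (auto simp: indep_vars_def)
    then show ?thesis unfolding J_def by measurable
  qed
  have AE_path: "AE \<omega> in M. cadlag_on_nonneg (\<lambda>u. X u \<omega>) \<and> X 0 \<omega> = 0"
    using cadlag_paths start_0 by eventually_elim auto
  have lim: "(\<lambda>n. S s n \<omega>) \<longlonglongrightarrow> weighted_integral \<beta> (\<psi> \<omega>) s"
    if "cadlag_on_nonneg (\<lambda>u. X u \<omega>) \<and> X 0 \<omega> = 0" "\<omega> \<in> space M" "- R \<le> s" "s < 0" for \<omega> s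
    unfolding S_def using that \<psi> by (intro weighted_increments_tendsto) auto
  have AE_J: "AE \<omega> in M. J s \<omega> = weighted_integral \<beta> (\<psi> \<omega>) s" if s: "- R \<le> s" "s < 0" for s
    using AE_path AE_space by eventually_elim (use lim s in \<open>auto simp: J_def intro!: limI\<close>)
  have AE_S: "AE \<omega> in M. (\<lambda>n. S s n \<omega>) \<longlonglongrightarrow> J s \<omega>" if s: "- R \<le> s" "s < 0" for s
    using AE_path AE_space AE_J[OF s] by eventually_elim (use lim s in auto)
  have pJ: "prob {\<omega>\<in>space M. \<bar>J s \<omega>\<bar> \<ge> x} \<le> C * x powr (- \<gamma>)" if s: "- R \<le> s" "s < 0" for s
  proof (rule prob_ge_le_moment[OF J_rv[OF s] _ x \<gamma> C])
    have "(\<integral>\<^sup>+\<omega>. ennreal (\<bar>J s \<omega>\<bar> powr \<gamma>) \<partial>M) = (\<integral>\<^sup>+\<omega>. ennreal (\<bar>weighted_integral \<beta> (\<psi> \<omega>) s\<bar> powr \<gamma>) \<partial>M)"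
      by (rule nn_integral_cong_AE) (use AE_J[OF s] in eventually_elim, simp)
    then show "(\<integral>\<^sup>+\<omega>. ennreal (\<bar>J s \<omega>\<bar> powr \<gamma>) \<partial>M) \<le> ennreal C" using mom[OF s] by simp
  qed
  define pt where "pt n c = - R * real c / 2 ^ n" for n c :: nat
  have pt: "- R \<le> pt n c" "pt n c < 0" if "c \<in> {1..2 ^ n}" for n c
  proof -
    have "real c \<le> real (2 ^ n)" using that by (simp only: of_nat_le_iff atLeastAtMost_iff)
    then have c: "1 \<le> real c" "real c \<le> 2 ^ n" using that by auto
    have "R * real c \<le> R * 2 ^ n" using c R by (intro mult_left_mono) auto
    then show "- R \<le> pt n c" unfolding pt_def by (simp add: field_simps)
    show "pt n c < 0" unfolding pt_def using c R by (simp add: divide_less_0_iff)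
  qed
  define E where "E n = {\<omega>\<in>space M. \<exists>c\<in>{1..2 ^ n}. \<bar>J (pt n c) \<omega>\<bar> > 3 * x}" for n
  have E_sets: "E n \<in> events" for n
    unfolding E_def using J_rv[OF pt] by (intro sets.sets_Collect_finite_Ex) auto
  have E_prob: "prob (E n) \<le> 3 * (C * x powr (- \<gamma>))" for n
    unfolding E_def
  \<comment> \<open>Cutting the window into \<open>2 ^ n * Suc m\<close> pieces puts every
    \<open>pt n c\<close> on one common mesh. The first \<open>c * Suc m\<close> pieces reach from
    \<open>0\<close> to \<open>pt n c\<close>, and the last of them is dropped. So all these
    integrals are limits of partial sums of the same independent variables.\<close>
  proof (rule etemadi_maximal_inequality_limit[where n = "2 ^ n" and k = "\<lambda>m c. c * Suc m - 1"
        and X = "\<lambda>m i \<omega>. weighted_increments \<beta> (\<lambda>u. X u \<omega>) V (- R) (2 ^ n * Suc m) i"])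
    fix m
    show "indep_vars (\<lambda>_. borel) (\<lambda>i \<omega>. weighted_increments \<beta> (\<lambda>u. X u \<omega>) V (- R) (2 ^ n * Suc m) i)
        {..<2 ^ n * Suc m - 1}"
      by (rule indep_vars_subset[OF weighted_increments_indep[OF \<open>time_change V R\<close>]]) (use R in auto)
  next
    fix c :: nat assume c: "c \<in> {1..2 ^ n}"
    show "random_variable borel (J (pt n c))" by (rule J_rv[OF pt[OF c]])
    show "prob {\<omega>\<in>space M. \<bar>J (pt n c) \<omega>\<bar> \<ge> x} \<le> C * x powr (- \<gamma>)" by (rule pJ[OF pt[OF c]])
    show "c * Suc m - 1 \<le> 2 ^ n * Suc m - 1" for m
      using c by (intro diff_le_mono mult_right_mono) auto
    \<comment> \<open>The partial sums on the common mesh form a subsequence of the approximations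
      to the integral over \<open>pt n c\<close> to \<open>0\<close>.\<close>
    have sub: "filterlim (\<lambda>m. c * Suc m) sequentially sequentially"
      using c by (intro filterlim_subseq strict_monoI) auto
    have eq: "(\<Sum>i<c * Suc m - 1. weighted_increments \<beta> (\<lambda>u. X u \<omega>) V (- R) (2 ^ n * Suc m) i) = S (pt n c) (c * Suc m) \<omega>"
      for m \<omega>
    proof -
      have "- R * a / real (2 ^ n * Suc m) = pt n c * a / real (c * Suc m)" for a
      proof -
        have "real c \<noteq> 0" using c by simp
        then show ?thesis unfolding pt_def of_nat_mult by (simp add: divide_simps)
      qed
      then show ?thesis unfolding S_def weighted_increments_def by (simp only:)
    qed
    show "AE \<omega> in M. (\<lambda>m. \<Sum>i<c * Suc m - 1. weighted_increments \<beta> (\<lambda>u. X u \<omega>) V (- R) (2 ^ n * Suc m) i)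
        \<longlonglongrightarrow> J (pt n c) \<omega>"
      unfolding eq using AE_S[OF pt[OF c]] by eventually_elim (rule filterlim_compose[OF _ sub])
  qed auto
  have "incseq E"
  proof (rule incseq_SucI, rule subsetI)
    fix n \<omega> assume "\<omega> \<in> E n"
    then obtain c where c: "c \<in> {1..2 ^ n}" "\<bar>J (pt n c) \<omega>\<bar> > 3 * x" "\<omega> \<in> space M" unfolding E_def by blast
    have "pt (Suc n) (2 * c) = pt n c" by (simp add: pt_def)
    then have "2 * c \<in> {1..2 ^ Suc n} \<and> \<bar>J (pt (Suc n) (2 * c)) \<omega>\<bar> > 3 * x" using c by auto
    then show "\<omega> \<in> E (Suc n)" using c(3) unfolding E_def by blast
  qed
  then have "(\<lambda>n. prob (E n)) \<longlonglongrightarrow> prob (\<Union>n. E n)"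
    using E_sets by (intro finite_Lim_measure_incseq) auto
  then have UE: "prob (\<Union>n. E n) \<le> 3 * (C * x powr (- \<gamma>))"
    by (rule LIMSEQ_le_const2) (use E_prob in blast)
  \<comment> \<open>Dyadic points are countable, so one null set serves them all.\<close>
  have AE_all: "AE \<omega> in M. \<forall>n. \<forall>c\<in>{1..2 ^ n}. J (pt n c) \<omega> = weighted_integral \<beta> (\<psi> \<omega>) (pt n c)"
    unfolding AE_all_countable using AE_J[OF pt] by (auto intro!: AE_finite_allI)
  have "prob {\<omega>\<in>space M. \<bar>X u \<omega>\<bar> > 6 * exp (\<beta> * R) * x} \<le> prob (\<Union>n. E n)"
  proof (rule finite_measure_mono_AE)
    show "AE \<omega> in M. \<omega> \<in> {\<omega>\<in>space M. \<bar>X u \<omega>\<bar> > 6 * exp (\<beta> * R) * x} \<longrightarrow> \<omega> \<in> (\<Union>n. E n)"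
      using AE_path AE_all AE_space
    proof eventually_elim
      case (elim \<omega>)
      show ?case
      proof (rule impI, rule ccontr)
        assume *: "\<omega> \<in> {\<omega>\<in>space M. \<bar>X u \<omega>\<bar> > 6 * exp (\<beta> * R) * x}" "\<omega> \<notin> (\<Union>n. E n)"
        have "\<bar>weighted_integral \<beta> (\<psi> \<omega>) (- R * real c / 2 ^ n)\<bar> \<le> 3 * x" if c: "c \<in> {1..2 ^ n}" for n c
        proof -
          have "\<bar>J (pt n c) \<omega>\<bar> \<le> 3 * x" using *(2) elim(3) c unfolding E_def by force
          then show ?thesis using elim(2) c by (simp add: pt_def)
        qed
        then have "\<bar>X u \<omega>\<bar> \<le> 2 * exp (\<beta> * R) * (3 * x)"
          using elim \<psi> by (intro bound_from_weighted_integral[where \<psi> = "\<psi> \<omega>" and \<beta> = \<beta>] \<beta> R u) auto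
        then show False using *(1) by simp
      qed
    qed
  qed (use E_sets in auto)
  with UE show ?thesis by simp
qed

end

section \<open>From tails over a bounded time interval to polynomial growth\<close>

lemma cadlag_bound_from_grid:
  assumes f: "cadlag_on_nonneg f" and T: "T > 0" and a: "a \<ge> 0"
    and grid: "\<And>m i. i \<le> 2 ^ m \<Longrightarrow> \<bar>f (a + real i * T / 2 ^ m) - f a\<bar> \<le> K"
    and u: "a \<le> u" "u < a + T"
  shows "\<bar>f u - f a\<bar> \<le> K"
proof -
  \<comment> \<open>Floor plus one makes \<open>r m\<close> the first grid point strictly to the
    right of \<open>u\<close>. It still lies in the block because \<open>u < a + T\<close>.\<close>
  define i where "i m = nat \<lfloor>(u - a) / T * 2 ^ m\<rfloor> + 1" for m :: nat
  define r where "r m = a + real (i m) * T / 2 ^ m" for m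
  have i: "(u - a) / T * 2 ^ m < real (i m)" "real (i m) \<le> (u - a) / T * 2 ^ m + 1" for m
  proof -
    have "0 \<le> (u - a) / T * 2 ^ m" using u T by simp
    then show "(u - a) / T * 2 ^ m < real (i m)" "real (i m) \<le> (u - a) / T * 2 ^ m + 1"
      unfolding i_def by linarith+
  qed
  have i_le: "i m \<le> 2 ^ m" for m
  proof -
    have "(u - a) / T < 1" using u T by (subst pos_divide_less_eq) auto
    then have "(u - a) / T * 2 ^ m < 1 * 2 ^ m" by (intro mult_strict_right_mono) auto
    then have "\<lfloor>(u - a) / T * 2 ^ m\<rfloor> < 2 ^ m" by (subst floor_less_iff) simp
    moreover have "0 \<le> \<lfloor>(u - a) / T * 2 ^ m\<rfloor>" using u T by simp
    ultimately have "int (i m) \<le> int (2 ^ m)" unfolding i_def by simp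
    then show ?thesis by (simp only: of_nat_le_iff)
  qed
  have r_gt: "u < r m" for m
  proof -
    have "(u - a) / T * 2 ^ m * (T / 2 ^ m) < real (i m) * (T / 2 ^ m)"
      using i(1) T by (intro mult_strict_right_mono) auto
    then show ?thesis unfolding r_def using T by simp
  qed
  have r_le: "r m \<le> u + T / 2 ^ m" for m
  proof -
    have "real (i m) * (T / 2 ^ m) \<le> ((u - a) / T * 2 ^ m + 1) * (T / 2 ^ m)"
      using i(2) T by (intro mult_right_mono) auto
    also have "\<dots> = u - a + T / 2 ^ m" using T by (simp add: field_simps)
    finally show ?thesis unfolding r_def by simp
  qed
  have "(\<lambda>m. u + T / 2 ^ m) \<longlonglongrightarrow> u" by real_asymp
  then have "r \<longlonglongrightarrow> u"
    by (rule tendsto_sandwich[of "\<lambda>_. u", rotated 3]) (simp_all add: less_imp_le[OF r_gt] r_le)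
  then have rl: "filterlim r (at_right u) sequentially"
    by (rule tendsto_imp_filterlim_at_right) (simp add: r_gt)
  have "(f \<longlongrightarrow> f u) (at_right u)" using f a u unfolding cadlag_on_nonneg_def by simp
  then have "(\<lambda>m. \<bar>f (r m) - f a\<bar>) \<longlonglongrightarrow> \<bar>f u - f a\<bar>"
    by (intro tendsto_intros filterlim_compose[OF _ rl])
  then show ?thesis
    by (rule LIMSEQ_le_const2) (use grid[OF i_le] in \<open>auto simp: r_def\<close>)
qed

text \<open>Telescoping over about \<open>n\<close> blocks, each contributing at most order
  \<open>n powr q\<close>, gives order \<open>n powr (1 + q)\<close> at the block ends; the
  oscillation inside the last block is of smaller order.\<close>

lemma cadlag_growth_from_grid:
  assumes f: "cadlag_on_nonneg f" and T: "T > 0" and q: "q > 0"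
    and grid: "\<And>n m i. n \<ge> N \<Longrightarrow> i \<le> 2 ^ m \<Longrightarrow>
      \<bar>f (real n * T + real i * T / 2 ^ m) - f (real n * T)\<bar> \<le> 3 * real (Suc n) powr q"
  shows "\<exists>B. \<forall>u\<ge>real N * T. \<bar>f u\<bar> \<le> B * (1 + u / T) powr (1 + q)"
proof -
  define b where "b = \<bar>f (real N * T)\<bar>"
  have at_grid: "\<bar>f (real n * T)\<bar> \<le> b + 3 * (real n * real n powr q)" if "n \<ge> N" for n
    using that
  proof (induction n rule: dec_induct)
    case base
    then show ?case by (simp add: b_def)
  next
    case (step n)
    \<comment> \<open>The end of block \<open>n\<close> is grid point \<open>1\<close> of the
      coarsest grid, \<open>m = 0\<close>.\<close>
    have "\<bar>f (real (Suc n) * T) - f (real n * T)\<bar> \<le> 3 * real (Suc n) powr q"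
      using grid[of n "2 ^ 0" 0] step by (simp add: algebra_simps)
    moreover have "real n * real n powr q \<le> real n * real (Suc n) powr q"
      using q by (intro mult_left_mono powr_mono2) auto
    moreover have "real n * real (Suc n) powr q + real (Suc n) powr q = real (Suc n) * real (Suc n) powr q"
      by (simp add: algebra_simps)
    ultimately show ?case using step.IH by linarith
  qed
  have "\<bar>f u\<bar> \<le> (b + 3) * (1 + u / T) powr (1 + q)" if u: "u \<ge> real N * T" for u
  proof -
    define n where "n = nat \<lfloor>u / T\<rfloor>"
    have "0 \<le> real N * T" using T by simp
    then have "0 \<le> u" using u by linarith
    then have u0: "u / T \<ge> 0" using T by simp
    have n: "real n \<le> u / T" "u / T < real n + 1" unfolding n_def using u0 by linarith+
    have "real N \<le> u / T" using u T by (simp add: pos_le_divide_eq)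
    then have nN: "n \<ge> N" unfolding n_def by (simp add: le_nat_iff le_floor_iff)
    have "\<bar>f u - f (real n * T)\<bar> \<le> 3 * real (Suc n) powr q"
    proof (rule cadlag_bound_from_grid[OF f T _ grid[OF nN]])
      show "real n * T \<le> u" using n(1) T by (simp add: pos_le_divide_eq)
      show "u < real n * T + T" using n(2) T by (simp add: pos_divide_less_eq algebra_simps)
    qed (use T in auto)
    then have "\<bar>f u\<bar> \<le> b + 3 * (real n * real n powr q) + 3 * real (Suc n) powr q"
      using at_grid[OF nN] by linarith
    also have "\<dots> \<le> b + 3 * (real n * real (Suc n) powr q) + 3 * real (Suc n) powr q"
      using q by (intro add_mono mult_left_mono powr_mono2) auto
    also have "\<dots> = b * 1 + 3 * (real (Suc n) * real (Suc n) powr q)" by (simp add: algebra_simps)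
    also have "\<dots> = b * 1 + 3 * real (Suc n) powr (1 + q)" by (simp add: powr_add)
    also have "\<dots> \<le> b * (1 + u / T) powr (1 + q) + 3 * (1 + u / T) powr (1 + q)"
      using n(1) q u0 by (intro add_mono mult_left_mono powr_mono2 ge_one_powr_ge_zero) (auto simp: b_def)
    finally show ?thesis by (simp add: algebra_simps)
  qed
  then show ?thesis by blast
qed

text \<open>Stationarity gives increments inside each block the tail known near time
  \<open>0\<close>, and Etemadi's inequality makes it a tail of the block oscillation. At level
  \<open>(n + 1) powr q\<close> the probabilities are summable because
  \<open>q * \<gamma> > 1\<close>, so Borel-Cantelli applies.\<close>

lemma (in levy_process) growth_from_tail:
  assumes T: "T > 0" and q: "q > 0" "q * \<gamma> > 1"
    and tail: "\<And>u x. 0 \<le> u \<Longrightarrow> u \<le> T \<Longrightarrow> x > 0 \<Longrightarrow>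
      prob {\<omega>\<in>space M. \<bar>X u \<omega>\<bar> > x} \<le> D * x powr (- \<gamma>)"
  shows "AE \<omega> in M. \<exists>N B. \<forall>u\<ge>N. \<bar>X u \<omega>\<bar> \<le> B * (1 + u / T) powr (1 + q)"
proof -
  define pt where "pt n m i = real n * T + real i * T / 2 ^ m" for n m i :: nat
  have pt0: "0 \<le> pt n m i" for n m i unfolding pt_def using T by simp
  have [measurable]: "random_variable borel (X (pt n m i))" "random_variable borel (X (real n * T))" for n m i
    using pt0 T by (auto intro: rv)
  define E where "E n m = {\<omega>\<in>space M. \<exists>i\<in>{..2 ^ m}. \<bar>X (pt n m i) \<omega> - X (real n * T) \<omega>\<bar> > 3 * real (Suc n) powr q}"
    for n m
  have E_sets[measurable]: "E n m \<in> events" for n m unfolding E_def by measurable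
  have E_prob: "prob (E n m) \<le> 3 * (D * (real (Suc n) powr q) powr (- \<gamma>))" for n m
  proof -
    have tele: "(\<Sum>i<k. X (pt n m (Suc i)) \<omega> - X (pt n m i) \<omega>) = X (pt n m k) \<omega> - X (real n * T) \<omega>" for k \<omega>
      by (subst sum_lessThan_telescope) (simp add: pt_def)
    have "prob {\<omega>\<in>space M. \<exists>k\<in>{..2 ^ m}. \<bar>\<Sum>i<k. X (pt n m (Suc i)) \<omega> - X (pt n m i) \<omega>\<bar> > 3 * (real (Suc n) powr q)}
       \<le> 3 * (D * (real (Suc n) powr q) powr (- \<gamma>))"
    proof (rule etemadi_maximal_inequality[where n = "2 ^ m"])
      show "indep_vars (\<lambda>_. borel) (\<lambda>i \<omega>. X (pt n m (Suc i)) \<omega> - X (pt n m i) \<omega>) {..<2 ^ m}"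
        by (rule indep_increments[where t = "pt n m", OF pt0]) (use T in \<open>simp add: pt_def divide_strict_right_mono\<close>)
    next
      fix k :: nat assume k: "k \<in> {..2 ^ m}"
      define t where "t = real k * T / 2 ^ m"
      have "real k \<le> real (2 ^ m)" using k by (simp only: of_nat_le_iff atMost_iff)
      then have "real k \<le> 2 ^ m" by simp
      then have "real k * T \<le> 2 ^ m * T" using T by (intro mult_right_mono) auto
      then have t: "0 \<le> t" "t \<le> T" unfolding t_def using T by (simp_all add: pos_divide_le_eq mult.commute)
      have [measurable]: "random_variable borel (X t)" by (rule rv[OF t(1)])
      have "prob {\<omega>\<in>space M. \<bar>X (pt n m k) \<omega> - X (real n * T) \<omega>\<bar> > real (Suc n) powr q}
         = measure (distr M borel (\<lambda>\<omega>. X (real n * T + t) \<omega> - X (real n * T) \<omega>)) {y. \<bar>y\<bar> > real (Suc n) powr q}"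
        unfolding pt_def t_def[symmetric] using rv[of "real n * T + t"] t T
        by (subst measure_distr) (auto intro!: arg_cong[where f = prob])
      also have "\<dots> = measure (distr M borel (X t)) {y. \<bar>y\<bar> > real (Suc n) powr q}"
        using stationary_increments[of "real n * T" t] T t by simp
      also have "\<dots> = prob {\<omega>\<in>space M. \<bar>X t \<omega>\<bar> > real (Suc n) powr q}"
        by (subst measure_distr) (auto intro!: arg_cong[where f = prob])
      also have "\<dots> \<le> D * (real (Suc n) powr q) powr (- \<gamma>)" by (rule tail[OF t]) simp
      finally show "prob {\<omega>\<in>space M. \<bar>\<Sum>i<k. X (pt n m (Suc i)) \<omega> - X (pt n m i) \<omega>\<bar> > real (Suc n) powr q}
         \<le> D * (real (Suc n) powr q) powr (- \<gamma>)" unfolding tele .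
    qed auto
    then show ?thesis unfolding tele E_def .
  qed
  \<comment> \<open>Dyadic refinement keeps the old grid points, so the bound, which is uniform in
    \<open>m\<close>, passes to the union over all grids.\<close>
  have inc: "incseq (E n)" for n
  proof (rule incseq_SucI, rule subsetI)
    fix m \<omega> assume "\<omega> \<in> E n m"
    then obtain i where i: "i \<le> 2 ^ m" "\<bar>X (pt n m i) \<omega> - X (real n * T) \<omega>\<bar> > 3 * real (Suc n) powr q" "\<omega> \<in> space M"
      unfolding E_def by blast
    have "pt n (Suc m) (2 * i) = pt n m i" by (simp add: pt_def)
    then have "2 * i \<in> {..2 ^ Suc m} \<and> \<bar>X (pt n (Suc m) (2 * i)) \<omega> - X (real n * T) \<omega>\<bar> > 3 * real (Suc n) powr q"
      using i by simp
    then show "\<omega> \<in> E n (Suc m)" using i(3) unfolding E_def by blast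
  qed
  define G where "G n = (\<Union>m. E n m)" for n
  have G_sets: "G n \<in> events" for n unfolding G_def by auto
  have G_prob: "prob (G n) \<le> 3 * D * real (Suc n) powr (- (q * \<gamma>))" for n
  proof -
    have "(\<lambda>m. prob (E n m)) \<longlonglongrightarrow> prob (G n)"
      unfolding G_def using inc by (intro finite_Lim_measure_incseq) auto
    then have "prob (G n) \<le> 3 * (D * (real (Suc n) powr q) powr (- \<gamma>))"
      by (rule LIMSEQ_le_const2) (use E_prob in blast)
    then show ?thesis by (simp add: powr_powr)
  qed
  have "summable (\<lambda>n. real n powr (- (q * \<gamma>)))" using q by (subst summable_real_powr_iff) auto
  then have "summable (\<lambda>n. real (Suc n) powr (- (q * \<gamma>)))"
    using summable_Suc_iff[of "\<lambda>n. real n powr (- (q * \<gamma>))"] by simp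
  then have "summable (\<lambda>n. 3 * D * real (Suc n) powr (- (q * \<gamma>)))" by (rule summable_mult)
  then have "summable (\<lambda>n. prob (G n))"
    by (rule summable_comparison_test[rotated]) (use G_prob in \<open>auto simp: measure_nonneg\<close>)
  then have "AE \<omega> in M. eventually (\<lambda>n. \<omega> \<in> space M - G n) sequentially"
    using G_sets by (intro borel_cantelli_AE1) (auto simp: emeasure_eq_measure)
  with cadlag_paths show ?thesis
  proof eventually_elim
    case (elim \<omega>)
    then obtain N where N: "\<And>n. n \<ge> N \<Longrightarrow> \<omega> \<in> space M - G n" unfolding eventually_sequentially by blast
    have "\<bar>X (pt n m i) \<omega> - X (real n * T) \<omega>\<bar> \<le> 3 * real (Suc n) powr q" if "n \<ge> N" "i \<le> 2 ^ m" for n m i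
      using N[OF that(1)] that(2) unfolding G_def E_def by (force simp: not_less)
    then have "\<exists>B. \<forall>u\<ge>real N * T. \<bar>X u \<omega>\<bar> \<le> B * (1 + u / T) powr (1 + q)"
      using elim(1) by (intro cadlag_growth_from_grid T q) (auto simp: pt_def)
    then show ?case by blast
  qed
qed

section \<open>Convergence of the random integral\<close>

text \<open>The random integral along one fixed path: both the boundary term at \<open>a\<close> and
  the integrand are of order \<open>exp ((\<beta> - \<theta>) * t)\<close> at minus
  infinity.\<close>

lemma random_integral_exp_converges:
  fixes y :: "real \<Rightarrow> real"
  assumes rc: "\<And>t. (y \<longlongrightarrow> y t) (at_right t)"
    and bdd: "\<And>a b. \<exists>B. \<forall>t\<in>{a..b}. \<bar>y t\<bar> \<le> B"
    and dom: "\<And>t. t \<le> c \<Longrightarrow> \<bar>y t\<bar> \<le> C * exp (- \<theta> * t)" and \<theta>: "\<theta> < \<beta>"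
  shows "\<exists>l. ((\<lambda>a. exp (b * \<beta>) * y b - exp (a * \<beta>) * y a -
     integral {a..b} (\<lambda>t. deriv (\<lambda>t. exp (t * \<beta>)) t * y t)) \<longlongrightarrow> l) at_bot"
proof -
  define f where "f t = \<beta> * exp (t * \<beta>) * y t" for t
  have D: "((\<lambda>t. exp (t * \<beta>)) has_real_derivative \<beta> * exp (t * \<beta>)) (at t)" for t
    by (auto intro!: derivative_eq_intros)
  have eq: "deriv (\<lambda>t. exp (t * \<beta>)) t * y t = f t" for t
    using DERIV_imp_deriv[OF D] by (simp add: f_def)
  have int: "f integrable_on {a..b}" for a
  proof (cases "a < b")
    case True
    obtain B where B: "\<forall>t\<in>{a..b}. \<bar>y t\<bar> \<le> B" using bdd by blast
    show ?thesis unfolding f_def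
      \<comment> \<open>Integrability comes from the step approximation, taken with the path as its
        own right limit.\<close>
      by (rule step_sums_tendsto_integral(1)[OF True rc _ D, where B = B])
        (use B in \<open>auto intro!: continuous_intros\<close>)
  next
    case False
    then show ?thesis using integrable_on_refl[of f b] by (cases "a = b") auto
  qed
  have e1: "exp (t * \<beta>) * \<bar>y t\<bar> \<le> C * exp ((\<beta> - \<theta>) * t)" if "t \<le> c" for t
  proof -
    have "exp (t * \<beta>) * \<bar>y t\<bar> \<le> exp (t * \<beta>) * (C * exp (- \<theta> * t))"
      using dom[OF that] by (intro mult_left_mono) auto
    also have "\<dots> = C * (exp (t * \<beta>) * exp (- \<theta> * t))" by simp
    also have "\<dots> = C * exp ((\<beta> - \<theta>) * t)" unfolding exp_add[symmetric] by (simp add: algebra_simps)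
    finally show ?thesis .
  qed
  have "\<bar>f t\<bar> \<le> \<bar>\<beta>\<bar> * C * exp ((\<beta> - \<theta>) * t)" if "t \<le> c" for t
    using mult_left_mono[OF e1[OF that], of "\<bar>\<beta>\<bar>"] by (simp add: f_def abs_mult mult.assoc)
  then obtain l where l: "((\<lambda>a. integral {a..b} f) \<longlongrightarrow> l) at_bot"
    using improper_integral_at_bot_converges[OF int, of c "\<bar>\<beta>\<bar> * C" "\<beta> - \<theta>"] \<theta> by auto
  have "((\<lambda>a. exp (a * \<beta>) * y a) \<longlongrightarrow> 0) at_bot"
  proof (rule Lim_null_comparison)
    show "eventually (\<lambda>a. norm (exp (a * \<beta>) * y a) \<le> C * exp ((\<beta> - \<theta>) * a)) at_bot"
      using eventually_le_at_bot[of c] by eventually_elim (use e1 in \<open>simp add: abs_mult\<close>)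
    have "\<beta> - \<theta> > 0" using \<theta> by simp
    then show "((\<lambda>a. C * exp ((\<beta> - \<theta>) * a)) \<longlongrightarrow> 0) at_bot" by real_asymp
  qed
  then have "((\<lambda>a. exp (b * \<beta>) * y b - exp (a * \<beta>) * y a - integral {a..b} f) \<longlongrightarrow> exp (b * \<beta>) * y b - 0 - l) at_bot"
    by (intro tendsto_intros l)
  then show ?thesis unfolding eq by blast
qed

theorem lemma2p9:
  fixes M :: "'a measure" and \<mu> :: "real measure"
    and \<alpha> \<delta> :: real and L Y :: "real \<Rightarrow> 'a \<Rightarrow> real"
  assumes "\<delta> \<noteq> 0"
    and "infinitely_divisible \<mu>"
    and "two_sided_levy_process M \<mu> L"
    and "\<And>t \<omega>. Y t \<omega> = L ((exp (\<delta> * t) - 1) / (exp \<delta> - 1)) \<omega>"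
    and "(\<delta> > 0 \<and> \<alpha> > \<delta> / 2) \<or>
         (\<delta> < 0 \<and> \<alpha> > - \<delta> / 2 \<and>
          (\<exists>\<gamma>::real. \<gamma> > - \<delta> / (\<alpha> + \<delta> / 2) \<and>
             (SUP s\<in>{1 / \<delta> * ln 2..0}.
                \<integral>\<^sup>+\<omega>. ennreal (\<bar>random_integral (\<lambda>t. exp (t * (\<alpha> - \<delta> / 2))) Y s 0 \<omega>\<bar> powr \<gamma>) \<partial>M)
             < \<infinity>))"
  shows "\<forall>b::real. AE \<omega> in M. \<exists>l::real.
           ((\<lambda>a. random_integral (\<lambda>t. exp (t * (\<alpha> - \<delta> / 2))) Y a b \<omega>) \<longlongrightarrow> l) at_bot"
proof
  fix b :: real
  define \<beta> where "\<beta> = \<alpha> - \<delta> / 2"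
  define \<tau> where "\<tau> t = (exp (\<delta> * t) - 1) / (exp \<delta> - 1)" for t
  from assms(3) obtain L1 L2 where L1: "levy_process M L1" and L2: "levy_process M L2"
    and L: "\<And>t \<omega>. \<omega> \<in> space M \<Longrightarrow> L t \<omega> = (if t \<ge> 0 then L1 t \<omega> else - Lim (at_left (- t)) (\<lambda>s. L2 s \<omega>))"
    unfolding two_sided_levy_process_def by blast
  interpret L1: levy_process M L1 by (rule L1)
  interpret L2: levy_process M L2 by (rule L2)
  have Y: "Y t \<omega> = two_sided_path (\<lambda>t. L1 t \<omega>) (\<lambda>t. L2 t \<omega>) (\<tau> t)" if "\<omega> \<in> space M" for t \<omega>
    using assms(4)[of t \<omega>] L[OF that] by (simp add: two_sided_path_def \<tau>_def)
  \<comment> \<open>For \<open>\<delta> < 0\<close> the numerator decreases while the denominator is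
    negative, so the clock increases in both cases.\<close>
  have \<tau>_less: "\<tau> s < \<tau> t" if "s < t" for s t
  proof (cases "\<delta> > 0")
    case True
    then show ?thesis unfolding \<tau>_def using that by (intro divide_strict_right_mono) auto
  next
    case False
    then have "\<delta> < 0" using \<open>\<delta> \<noteq> 0\<close> by simp
    then show ?thesis unfolding \<tau>_def using that by (intro divide_strict_right_mono_neg) auto
  qed
  have \<tau>_0: "\<tau> 0 = 0" by (simp add: \<tau>_def)
  have \<tau>_cont: "isCont \<tau> t" for t unfolding \<tau>_def using \<open>\<delta> \<noteq> 0\<close> by (intro continuous_intros) auto
  have \<tau>_right: "filterlim \<tau> (at_right (\<tau> t)) (at_right t)" for t
  proof (rule tendsto_imp_filterlim_at_right)
    show "(\<tau> \<longlongrightarrow> \<tau> t) (at_right t)"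
      using \<tau>_cont[of t] unfolding isCont_def by (rule tendsto_within_subset) auto
    show "eventually (\<lambda>s. \<tau> s > \<tau> t) (at_right t)"
      unfolding eventually_at_right_field using \<tau>_less by (intro exI[of _ "t + 1"]) auto
  qed
  have converges: "\<exists>l. ((\<lambda>a. random_integral (\<lambda>t. exp (t * (\<alpha> - \<delta> / 2))) Y a b \<omega>) \<longlongrightarrow> l) at_bot"
    if \<omega>: "\<omega> \<in> space M" "cadlag_on_nonneg (\<lambda>t. L1 t \<omega>)" "cadlag_on_nonneg (\<lambda>t. L2 t \<omega>)"
      and dom: "\<And>t. t \<le> c \<Longrightarrow> \<bar>Y t \<omega>\<bar> \<le> C * exp (- \<theta> * t)" and \<theta>: "\<theta> < \<beta>" for \<omega> c C \<theta>
    unfolding random_integral_def \<beta>_def[symmetric]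
  proof (rule random_integral_exp_converges[OF _ _ dom \<theta>])
    fix t
    show "((\<lambda>t. Y t \<omega>) \<longlongrightarrow> Y t \<omega>) (at_right t)"
      unfolding Y[OF \<omega>(1)]
      by (rule filterlim_compose[OF two_sided_path_right_continuous[OF \<omega>(2,3)] \<tau>_right])
  next
    fix a b
    obtain B where B: "\<forall>t\<in>{\<tau> a..\<tau> b}. \<bar>two_sided_path (\<lambda>t. L1 t \<omega>) (\<lambda>t. L2 t \<omega>) t\<bar> \<le> B"
      using two_sided_path_bounded[OF \<omega>(2,3)] by blast
    have "\<tau> t \<in> {\<tau> a..\<tau> b}" if "t \<in> {a..b}" for t
      using that \<tau>_less[of a t] \<tau>_less[of t b] by (cases "a = t"; cases "t = b") (auto simp: less_imp_le)
    then show "\<exists>B. \<forall>t\<in>{a..b}. \<bar>Y t \<omega>\<bar> \<le> B" using B unfolding Y[OF \<omega>(1)] by blast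
  qed
  from assms(5) consider (pos) "\<delta> > 0" "\<alpha> > \<delta> / 2" |
    (neg) \<gamma> where "\<delta> < 0" "\<alpha> > - \<delta> / 2" "\<gamma> > - \<delta> / (\<alpha> + \<delta> / 2)"
      "(SUP s\<in>{1 / \<delta> * ln 2..0}.
                \<integral>\<^sup>+\<omega>. ennreal (\<bar>random_integral (\<lambda>t. exp (t * (\<alpha> - \<delta> / 2))) Y s 0 \<omega>\<bar> powr \<gamma>) \<partial>M) < \<infinity>"
    by blast
  then show "AE \<omega> in M. \<exists>l. ((\<lambda>a. random_integral (\<lambda>t. exp (t * (\<alpha> - \<delta> / 2))) Y a b \<omega>) \<longlongrightarrow> l) at_bot"
  proof cases
    case pos
    then have \<beta>: "0 < \<beta>" unfolding \<beta>_def by linarith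
    show ?thesis
      using L1.cadlag_paths L2.cadlag_paths AE_space
    proof eventually_elim
      case (elim \<omega>)
      \<comment> \<open>For \<open>\<delta> > 0\<close> the clock stays above its limit
        \<open>- 1 / (exp \<delta> - 1)\<close> at minus infinity, so \<open>Y\<close> is bounded on
        the negative half-line and \<open>\<theta> = 0\<close> works.\<close>
      obtain B where B: "\<forall>t\<in>{- 1 / (exp \<delta> - 1)..0}. \<bar>two_sided_path (\<lambda>t. L1 t \<omega>) (\<lambda>t. L2 t \<omega>) t\<bar> \<le> B"
        using two_sided_path_bounded[OF elim(1,2)] by blast
      have "\<bar>Y t \<omega>\<bar> \<le> B * exp (- 0 * t)" if "t \<le> 0" for t
      proof -
        have "- 1 / (exp \<delta> - 1) \<le> \<tau> t" unfolding \<tau>_def using pos by (intro divide_right_mono) auto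
        moreover have "\<tau> t \<le> 0" using \<tau>_less[of t 0] \<tau>_0 that by (cases "t = 0") auto
        ultimately show ?thesis using B unfolding Y[OF elim(3)] by simp
      qed
      then show ?case by (rule converges[OF elim(3,1,2) _ \<beta>])
    qed
  next
    case neg
    \<comment> \<open>With this \<open>R\<close> the window from \<open>- R\<close> to
      \<open>0\<close> is the interval of the moment condition, and
      \<open>exp (- \<delta> * R) = 2\<close>.\<close>
    define R where "R = - ln 2 / \<delta>"
    define V where "V t = - \<tau> t" for t
    have R: "R > 0" unfolding R_def using neg(1) by (simp add: divide_pos_neg)
    have \<beta>\<delta>: "\<beta> + \<delta> > 0" using neg(2) unfolding \<beta>_def by simp
    then have \<beta>: "\<beta> > 0" using neg(1) by linarith
    have e\<delta>: "exp \<delta> < 1" using neg(1) by simp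
    have "\<delta> * (- R) = ln 2" unfolding R_def using neg(1) by simp
    then have VR: "V (- R) = 1 / (1 - exp \<delta>)" unfolding V_def \<tau>_def using e\<delta> by (simp add: field_simps)
    have V_eq: "V t = (exp (\<delta> * t) - 1) / (1 - exp \<delta>)" for t
      unfolding V_def \<tau>_def using e\<delta> by (simp add: field_simps)
    have tc: "time_change V R"
    proof
      show "V 0 = 0" by (simp add: V_def \<tau>_0)
      show "V t < V s" if "- R \<le> s" "s < t" "t \<le> 0" for s t using \<tau>_less that by (simp add: V_def)
      show "continuous_on {- R..0} V" unfolding V_def
        by (intro continuous_on_minus continuous_at_imp_continuous_on ballI \<tau>_cont)
    qed
    have \<psi>: "Y t \<omega> = - Lim (at_left (V t)) (\<lambda>u. L2 u \<omega>)" if "\<omega> \<in> space M" "t < 0" for t \<omega>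
      using \<tau>_less[OF that(2)] unfolding Y[OF that(1)] by (simp add: \<tau>_0 two_sided_path_def V_def)
    have \<gamma>: "\<gamma> > 0" "1 / \<gamma> < (\<beta> + \<delta>) / - \<delta>"
    proof -
      have 1: "\<alpha> + \<delta> / 2 = \<beta> + \<delta>" by (simp add: \<beta>_def)
      have 2: "- \<delta> / (\<beta> + \<delta>) > 0" using neg(1) \<beta>\<delta> by (intro divide_pos_pos) auto
      then show "\<gamma> > 0" using neg(3) unfolding 1 by linarith
      have "1 / \<gamma> < 1 / (- \<delta> / (\<beta> + \<delta>))" using 2 neg(3) unfolding 1 by (intro divide_strict_left_mono mult_pos_pos) auto
      then show "1 / \<gamma> < (\<beta> + \<delta>) / - \<delta>" by simp
    qed
    \<comment> \<open>The lower bound makes the Borel-Cantelli series converge. The upper bound puts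
      the growth exponent \<open>\<theta> = - \<delta> * (1 + q)\<close> below
      \<open>\<beta>\<close>. The hypothesis on \<open>\<gamma>\<close> says exactly that there is
      room between them.\<close>
    obtain q where q: "1 / \<gamma> < q" "q < (\<beta> + \<delta>) / - \<delta>" using dense[OF \<gamma>(2)] by blast
    have q_pos: "q > 0" using q(1) \<gamma>(1) by (smt (verit) divide_pos_pos)
    have q\<gamma>: "q * \<gamma> > 1" using q(1) \<gamma>(1) by (simp add: pos_divide_less_eq)
    have q\<beta>: "- \<delta> * (1 + q) < \<beta>" using q(2) neg(1) by (subst (asm) pos_less_divide_eq) (auto simp: algebra_simps)
    define W where "W = (SUP s\<in>{1 / \<delta> * ln 2..0}.
        \<integral>\<^sup>+\<omega>. ennreal (\<bar>random_integral (\<lambda>t. exp (t * \<beta>)) Y s 0 \<omega>\<bar> powr \<gamma>) \<partial>M)"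
    define C where "C = enn2real W"
    have "W < \<infinity>" unfolding W_def \<beta>_def by (rule neg(4))
    then have C: "C \<ge> 0" "ennreal C = W" unfolding C_def by simp_all
    \<comment> \<open>The random integral over \<open>s\<close> to \<open>0\<close> contains the
      boundary value \<open>Y 0\<close>, which vanishes only almost surely;
      \<open>weighted_integral\<close> leaves it out.\<close>
    have Y0: "AE \<omega> in M. Y 0 \<omega> = 0"
      using L1.start_0 AE_space by eventually_elim (simp add: Y \<tau>_0 two_sided_path_def)
    have mom: "(\<integral>\<^sup>+\<omega>. ennreal (\<bar>weighted_integral \<beta> (\<lambda>t. Y t \<omega>) s\<bar> powr \<gamma>) \<partial>M) \<le> ennreal C"
      if s: "- R \<le> s" "s < 0" for s
    proof -
      have "weighted_integral \<beta> (\<lambda>t. Y t \<omega>) s = random_integral (\<lambda>t. exp (t * \<beta>)) Y s 0 \<omega>" if "Y 0 \<omega> = 0" for \<omega>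
      proof -
        have "((\<lambda>t. exp (t * \<beta>)) has_real_derivative \<beta> * exp (\<beta> * t)) (at t)" for t
          by (auto intro!: derivative_eq_intros simp: mult.commute)
        then have "deriv (\<lambda>t. exp (t * \<beta>)) t = \<beta> * exp (\<beta> * t)" for t by (rule DERIV_imp_deriv)
        then show ?thesis using that by (simp add: weighted_integral_def random_integral_def mult.commute)
      qed
      then have "(\<integral>\<^sup>+\<omega>. ennreal (\<bar>weighted_integral \<beta> (\<lambda>t. Y t \<omega>) s\<bar> powr \<gamma>) \<partial>M)
        = (\<integral>\<^sup>+\<omega>. ennreal (\<bar>random_integral (\<lambda>t. exp (t * \<beta>)) Y s 0 \<omega>\<bar> powr \<gamma>) \<partial>M)"
        by (intro nn_integral_cong_AE) (use Y0 in eventually_elim, simp)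
      also have "\<dots> \<le> ennreal C" unfolding C(2) W_def
        by (intro SUP_upper) (use s in \<open>auto simp: R_def\<close>)
      finally show ?thesis .
    qed
    \<comment> \<open>The tail bound holds for times strictly below \<open>V (- R)\<close>; half of
      that leaves a closed interval inside.\<close>
    define T where "T = V (- R) / 2"
    \<comment> \<open>The constant absorbs the rescaling
      \<open>x = 6 * exp (\<beta> * R) * z\<close>.\<close>
    define D where "D = 3 * C * (6 * exp (\<beta> * R)) powr \<gamma>"
    have T: "T > 0" unfolding T_def VR using e\<delta> by simp
    have tail: "measure M {\<omega>\<in>space M. \<bar>L2 u \<omega>\<bar> > x} \<le> D * x powr (- \<gamma>)" if u: "0 \<le> u" "u \<le> T" and x: "x > 0" for u x
    proof -
      define z where "z = x / (6 * exp (\<beta> * R))"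
      have z: "z > 0" "6 * exp (\<beta> * R) * z = x" unfolding z_def using x by auto
      have "measure M {\<omega>\<in>space M. \<bar>L2 u \<omega>\<bar> > 6 * exp (\<beta> * R) * z} \<le> 3 * (C * z powr (- \<gamma>))"
        by (rule L2.tail_from_weighted_integral_moments[where \<psi> = "\<lambda>\<omega> t. Y t \<omega>", OF tc R \<beta> \<gamma>(1) C(1) \<psi> mom z(1)])
          (use u T in \<open>auto simp: T_def\<close>)
      also have "z powr (- \<gamma>) = x powr (- \<gamma>) * (6 * exp (\<beta> * R)) powr \<gamma>"
        unfolding z_def using x by (simp add: powr_divide powr_minus divide_simps)
      finally show ?thesis unfolding z(2) D_def by (simp add: mult_ac)
    qed
    have "AE \<omega> in M. \<exists>N B. \<forall>u\<ge>N. \<bar>L2 u \<omega>\<bar> \<le> B * (1 + u / T) powr (1 + q)"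
      by (rule L2.growth_from_tail[OF T q_pos q\<gamma> tail])
    with L1.cadlag_paths L2.cadlag_paths AE_space show ?thesis
    proof eventually_elim
      case (elim \<omega>)
      from elim(4) obtain N B where B: "\<And>u. u \<ge> N \<Longrightarrow> \<bar>L2 u \<omega>\<bar> \<le> B * (1 + u / T) powr (1 + q)" by blast
      \<comment> \<open>\<open>Y\<close> shows left limits of \<open>L2\<close>, so the growth bound
        is carried over to them. The absolute value of \<open>B\<close> makes the bound monotone in
        time.\<close>
      have left: "\<bar>Lim (at_left v) (\<lambda>u. L2 u \<omega>)\<bar> \<le> \<bar>B\<bar> * (1 + v / T) powr (1 + q)" if v: "v > max N 0" for v
      proof -
        have "Lim (at_left v) (\<lambda>u. L2 u \<omega>) \<in> cball 0 (\<bar>B\<bar> * (1 + v / T) powr (1 + q))"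
        proof (rule left_limit_mem_closed[OF elim(2)])
          fix w assume w: "max N 0 < w" "w < v"
          have "\<bar>L2 w \<omega>\<bar> \<le> B * (1 + w / T) powr (1 + q)" using w by (intro B) auto
          also have "\<dots> \<le> \<bar>B\<bar> * (1 + v / T) powr (1 + q)"
            using w T q_pos by (intro mult_mono powr_mono2 add_left_mono divide_right_mono) auto
          finally show "L2 w \<omega> \<in> cball 0 (\<bar>B\<bar> * (1 + v / T) powr (1 + q))" by simp
        qed (use v in auto)
        then show ?thesis by simp
      qed
      \<comment> \<open>Chosen so that \<open>exp (\<delta> * t) \<ge> m\<close> forces both
        \<open>t < 0\<close> and \<open>V t > max N 0\<close>.\<close>
      define m where "m = 2 + max N 0 * (1 - exp \<delta>)"
      have m: "m > 1" "max N 0 * (1 - exp \<delta>) < m - 1" unfolding m_def using e\<delta> by (simp_all add: add_pos_nonneg)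
      have "\<bar>Y t \<omega>\<bar> \<le> \<bar>B\<bar> * 2 powr (1 + q) * exp (- (- \<delta> * (1 + q)) * t)" if t: "t \<le> ln m / \<delta>" for t
      proof -
        have "ln m / \<delta> < 0" using m neg(1) by (simp add: divide_pos_neg)
        then have t0: "t < 0" using t by linarith
        have "ln m \<le> \<delta> * t" using t neg(1) by (simp add: neg_le_divide_eq mult.commute)
        then have "m \<le> exp (\<delta> * t)" using m by (simp add: ln_le_cancel_iff[symmetric] del: ln_le_cancel_iff)
        then have Vt: "V t > max N 0" unfolding V_eq using m e\<delta> by (subst pos_less_divide_eq) auto
        \<comment> \<open>\<open>T\<close> equals \<open>1 / (2 * (1 - exp \<delta>))\<close>, which
          cancels the denominator of \<open>V t\<close>.\<close>
        have "1 + V t / T = 2 * exp (\<delta> * t) - 1" unfolding T_def VR V_eq[of t] using e\<delta> by (simp add: field_simps)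
        moreover have "V t / T > 0" using Vt T by simp
        ultimately have "(1 + V t / T) powr (1 + q) \<le> (2 * exp (\<delta> * t)) powr (1 + q)"
          using q_pos by (intro powr_mono2) auto
        also have "\<dots> = 2 powr (1 + q) * exp (\<delta> * t * (1 + q))"
          by (subst powr_mult) (simp_all add: exp_powr_real)
        finally have "\<bar>B\<bar> * (1 + V t / T) powr (1 + q) \<le> \<bar>B\<bar> * (2 powr (1 + q) * exp (\<delta> * t * (1 + q)))"
          by (rule mult_left_mono) simp
        then show ?thesis using left[OF Vt] unfolding \<psi>[OF elim(3) t0] by (simp add: mult_ac)
      qed
      then show ?case by (rule converges[OF elim(3,1,2) _ q\<beta>])
    qed
  qed
qed

end
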